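(* Let $1\le p<\infty$ and $s\in\mathbb{R}$ satisfy $sp<-1$. Then the seminorm $\|\cdot\|_{\widehat b^s_{p,\infty}}$ is measurable on the real Hilbert space $H$ of real-valued mean-zero functions in $L^2(\mathbb{T})$, $\mathbb{T}=[0,2\pi)$.
   Context: Notation: $\langle n\rangle=1+|n|$, $\widehat f(n)$ are the Fourier coefficients of $f$, and $|n|\sim2^j$ means $2^j\le|n|<2^{j+1}$, $j\ge0$. For mean-zero $f$, $$\|f\|_{\widehat b^s_{p,\infty}}=\sup_{j\ge0}\Big(\sum_{|n|\sim2^j}\langle n\rangle^{sp}|\widehat f(n)|^p\Big)^{1/p}.$$ The Hilbert norm on $H$ is $\|\phi\|^2=\sum_{n\ge1}|a_n|^2$ for $\phi=\sum_{n\ne0}a_ne^{inx}$, $a_{-n}=\overline{a_n}$ (a constant multiple of the usual squared $L^2$ norm). Let $\mathcal{F}$ be the set of finite-dimensional orthogonal projections of $H$. A cylinder set is $E=\{x\in H:\mathbb{P}x\in F\}$ with $\mathbb{P}\in\mathcal{F}$ and $F$ a Borel subset of $\mathbb{P}H$. The Gauss measure $\mu$ on $H$ is the finitely additive measure on cylinder sets given by $\mu(E)=(2\pi)^{-n/2}\int_Fe^{-\|x\|^2/2}dx$, where $n=\dim\mathbb{P}H$ and $dx$ is Lebesgue measure on $\mathbb{P}H$. A seminorm $|||\cdot|||$ on $H$ is called measurable if for every $\varepsilon>0$ there exists $\mathbb{P}_0\in\mathcal{F}$ such that $\mu(\{x:|||\mathbb{P}x|||>\varepsilon\})<\varepsilon$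 for every $\mathbb{P}\in\mathcal{F}$ orthogonal to $\mathbb{P}_0$. *)

theory Defs
  imports "HOL-Analysis.Analysis"
begin

section \<open>The Hilbert space of real mean-zero functions on the circle\<close>

text \<open>Every Lebesgue measurable function agrees almost everywhere with a Borel one, so Borel
  measurable representatives give the usual \<open>L\<^sup>2\<close> space.\<close>

definition torus :: "real measure" where
  "torus = restrict_space lborel {0..<2 * pi}"

definition L2_mean_zero :: "(real \<Rightarrow> real) set" where
  "L2_mean_zero = {f \<in> borel_measurable torus.
     integrable torus (\<lambda>x. (f x)\<^sup>2) \<and> (LINT x|torus. f x) = 0}"

definition fourier_coeff :: "(real \<Rightarrow> real) \<Rightarrow> int \<Rightarrow> complex" where
  "fourier_coeff f n =
     1 / (2 * pi) * (LINT x|torus. complex_of_real (f x) * exp (- \<i> * of_int n * of_real x))"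

lemma space_torus [simp]: "space torus = {0..<2 * pi}"
  by (simp add: torus_def space_restrict_space)

lemma emeasure_torus: "emeasure torus (space torus) = ennreal (2 * pi)"
  unfolding torus_def by (subst emeasure_restrict_space) (auto simp: space_restrict_space)

interpretation torus: finite_measure torus
  by standard (simp add: emeasure_torus del: space_torus)

lemma measure_torus [simp]: "measure torus {0..<2 * pi} = 2 * pi"
  using emeasure_torus by (simp add: measure_def)

lemma borel_imp_torus [measurable (raw)]:
  "f \<in> borel_measurable borel \<Longrightarrow> f \<in> borel_measurable torus"
  unfolding torus_def by (intro measurable_restrict_space1) auto

lemma L2_mean_zeroD:
  assumes "f \<in> L2_mean_zero"
  shows "f \<in> borel_measurable torus" "integrable torus (\<lambda>x. (f x)\<^sup>2)"
    "integrable torus f" "(LINT x|torus. f x) = 0"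
  using assms by (auto simp: L2_mean_zero_def intro: torus.square_integrable_imp_integrable)

lemma L2_mean_zero_zero: "(\<lambda>_. 0) \<in> L2_mean_zero"
  by (auto simp: L2_mean_zero_def)

lemma L2_mean_zero_add:
  assumes "f \<in> L2_mean_zero" "g \<in> L2_mean_zero"
  shows "(\<lambda>x. f x + g x) \<in> L2_mean_zero"
proof -
  note [measurable] = L2_mean_zeroD(1)[OF assms(1)] L2_mean_zeroD(1)[OF assms(2)]
  note D = L2_mean_zeroD[OF assms(1)] L2_mean_zeroD[OF assms(2)]
  have "integrable torus (\<lambda>x. (f x + g x)\<^sup>2)"
  proof (rule Bochner_Integration.integrable_bound)
    show "integrable torus (\<lambda>x. 2 * (f x)\<^sup>2 + 2 * (g x)\<^sup>2)"
      using D by auto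
    have "(a + b)\<^sup>2 \<le> 2 * a\<^sup>2 + 2 * b\<^sup>2" for a b :: real
      using sum_squares_bound[of a b] by (simp add: power2_sum)
    then show "AE x in torus. norm ((f x + g x)\<^sup>2) \<le> norm (2 * (f x)\<^sup>2 + 2 * (g x)\<^sup>2)"
      by auto
  qed measurable
  then show ?thesis
    using D by (auto simp: L2_mean_zero_def)
qed

lemma L2_mean_zero_scale:
  assumes "f \<in> L2_mean_zero"
  shows "(\<lambda>x. c * f x) \<in> L2_mean_zero"
  using L2_mean_zeroD[OF assms] by (auto simp: L2_mean_zero_def power_mult_distrib)

quotient_type mean_zero_L2 = "real \<Rightarrow> real" / partial:
  "\<lambda>f g. f \<in> L2_mean_zero \<and> g \<in> L2_mean_zero \<and> (AE x in torus. f x = g x)"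
proof (rule part_equivpI)
  show "\<exists>f. f \<in> L2_mean_zero \<and> f \<in> L2_mean_zero \<and> (AE x in torus. f x = f x)"
    using L2_mean_zero_zero by auto
  show "symp (\<lambda>f g. f \<in> L2_mean_zero \<and> g \<in> L2_mean_zero \<and> (AE x in torus. f x = g x))"
    by (auto intro!: sympI)
  show "transp (\<lambda>f g. f \<in> L2_mean_zero \<and> g \<in> L2_mean_zero \<and> (AE x in torus. f x = g x))"
    by (rule transpI) (auto elim: AE_mp)
qed

lift_definition fourier :: "mean_zero_L2 \<Rightarrow> int \<Rightarrow> complex" is fourier_coeff
proof (intro ext)
  fix f g :: "real \<Rightarrow> real" and n
  assume fg: "f \<in> L2_mean_zero \<and> g \<in> L2_mean_zero \<and> (AE x in torus. f x = g x)"
  then have [measurable]: "f \<in> borel_measurable torus" "g \<in> borel_measurable torus"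
    by (auto simp: L2_mean_zero_def)
  have "(LINT x|torus. complex_of_real (f x) * exp (- \<i> * of_int n * of_real x)) =
        (LINT x|torus. complex_of_real (g x) * exp (- \<i> * of_int n * of_real x))"
    using fg by (intro integral_cong_AE) auto
  then show "fourier_coeff f n = fourier_coeff g n"
    by (simp add: fourier_coeff_def)
qed

instantiation mean_zero_L2 :: real_vector
begin

lift_definition zero_mean_zero_L2 :: mean_zero_L2 is "\<lambda>_. 0"
  using L2_mean_zero_zero by auto

lift_definition plus_mean_zero_L2 :: "mean_zero_L2 \<Rightarrow> mean_zero_L2 \<Rightarrow> mean_zero_L2"
  is "\<lambda>f g x. f x + g x"
  by (auto intro: L2_mean_zero_add)

lift_definition uminus_mean_zero_L2 :: "mean_zero_L2 \<Rightarrow> mean_zero_L2" is "\<lambda>f x. - f x"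
  using L2_mean_zero_scale[of _ "-1"] by auto

lift_definition minus_mean_zero_L2 :: "mean_zero_L2 \<Rightarrow> mean_zero_L2 \<Rightarrow> mean_zero_L2"
  is "\<lambda>f g x. f x - g x"
  using L2_mean_zero_add[OF _ L2_mean_zero_scale[of _ "-1"]] by auto

lift_definition scaleR_mean_zero_L2 :: "real \<Rightarrow> mean_zero_L2 \<Rightarrow> mean_zero_L2"
  is "\<lambda>c f x. c * f x"
  by (auto intro: L2_mean_zero_scale)

instance
proof
  fix a b c :: mean_zero_L2 and x y :: real
  show "a + b + c = a + (b + c)"
    by transfer (auto simp: add.assoc intro!: L2_mean_zero_add)
  show "a + b = b + a"
    by transfer (auto simp: add.commute intro!: L2_mean_zero_add)
  show "0 + a = a"
    by transfer auto
  show "- a + a = 0"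
    by transfer (auto simp: L2_mean_zero_zero)
  show "a - b = a + - b"
    by transfer (use L2_mean_zero_add[OF _ L2_mean_zero_scale[of _ "-1"]] in auto)
  show "x *\<^sub>R (a + b) = x *\<^sub>R a + x *\<^sub>R b"
    by transfer (auto simp: distrib_left intro!: L2_mean_zero_add L2_mean_zero_scale)
  show "(x + y) *\<^sub>R a = x *\<^sub>R a + y *\<^sub>R a"
    by transfer (auto simp: distrib_right intro!: L2_mean_zero_add L2_mean_zero_scale)
  show "x *\<^sub>R y *\<^sub>R a = (x * y) *\<^sub>R a"
    by transfer (auto simp: mult.assoc intro!: L2_mean_zero_scale)
  show "1 *\<^sub>R a = a"
    by transfer auto
qed

end

text \<open>The Hilbert norm is given by the Fourier coefficients. Bessel's inequality makes the series
  converge, and the uniqueness theorem for Fourier coefficients makes the norm definite.\<close>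

abbreviation (input) chr :: "int \<Rightarrow> real \<Rightarrow> complex" where
  "chr n x \<equiv> exp (\<i> * of_int n * of_real x)"

lemma norm_chr [simp]: "norm (exp (\<i> * of_int n * of_real x)) = 1"
  by (simp add: norm_exp_eq_Re)

lemma chr_mult: "chr n x * chr m x = chr (n + m) x"
  by (simp add: exp_add [symmetric] algebra_simps)

lemma cnj_chr: "cnj (chr n x) = chr (- n) x"
  by (simp add: exp_cnj)

lemma integrable_torus_bounded:
  fixes F h :: "real \<Rightarrow> complex"
  assumes "integrable torus F" "h \<in> borel_measurable torus" "\<And>x. norm (h x) \<le> B"
  shows "integrable torus (\<lambda>x. F x * h x)"
proof (rule Bochner_Integration.integrable_bound)
  show "integrable torus (\<lambda>x. of_real B * F x)"
    using assms by simp
  note [measurable] = assms(2) borel_measurable_integrable[OF assms(1)]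
  show "(\<lambda>x. F x * h x) \<in> borel_measurable torus"
    by measurable
  have "norm (F x * h x) \<le> norm (of_real B * F x)" for x
  proof -
    have "norm (F x) * norm (h x) \<le> norm (F x) * \<bar>B\<bar>"
      using assms(3)[of x] by (intro mult_left_mono) auto
    then show ?thesis by (simp add: norm_mult mult.commute)
  qed
  then show "AE x in torus. norm (F x * h x) \<le> norm (of_real B * F x)"
    by simp
qed

lemma integrable_chr: "integrable torus (chr n)"
  by (rule torus.integrable_const_bound[of _ 1]) auto

lemma integral_chr: "(LINT x|torus. chr n x) = (if n = 0 then 2 * pi else 0)"
proof (cases "n = 0")
  case True
  then show ?thesis by (simp add: scaleR_conv_of_real)
next
  case False
  have "(LINT x|torus. chr n x) = (LINT x:{0..<2*pi}|lborel. chr n x)"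
    unfolding torus_def by (subst integral_restrict_space) (auto simp: set_lebesgue_integral_def)
  also have "\<dots> = (LINT x:{0..2*pi}|lborel. chr n x)"
    unfolding set_lebesgue_integral_def
    by (intro integral_cong_AE) (use AE_lborel_singleton[of "2*pi"] in \<open>auto simp: indicator_def elim!: eventually_mono\<close>)
  also have "\<dots> = chr n (2*pi) / (\<i> * of_int n) - chr n 0 / (\<i> * of_int n)"
    unfolding set_lebesgue_integral_def
  proof (rule integral_FTC_atLeastAtMost)
    show "((\<lambda>x. chr n x / (\<i> * of_int n)) has_vector_derivative chr n x) (at x within {0..2*pi})" for x
      using False by (auto intro!: derivative_eq_intros has_vector_derivative_real_field)
    show "continuous_on {0..2*pi} (chr n)"
      by (intro continuous_intros)
  qed auto
  also have "\<dots> = 0"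
  proof -
    have "chr n (2*pi) = 1"
      using exp_integer_2pi[of "of_int n"] by (simp add: mult_ac)
    then show ?thesis by simp
  qed
  finally show ?thesis using False by simp
qed

lemma fourier_coeff_chr: "fourier_coeff f n = 1 / (2 * pi) * (LINT x|torus. of_real (f x) * chr (- n) x)"
  by (simp add: fourier_coeff_def)

lemma bessel_torus:
  assumes "f \<in> L2_mean_zero" "finite A"
  shows "(\<Sum>n\<in>A. (cmod (fourier_coeff f n))\<^sup>2) \<le> 1 / (2 * pi) * (LINT x|torus. (f x)\<^sup>2)"
proof -
  note D = L2_mean_zeroD[OF assms(1)]
  define a where "a = fourier_coeff f"
  define S where "S = (\<Sum>n\<in>A. (cmod (a n))\<^sup>2)"
  define g where "g = (\<lambda>x. of_real (f x) - (\<Sum>n\<in>A. a n * chr n x))"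
  have int_f: "integrable torus (\<lambda>x. of_real (f x) * chr n x)" for n
    by (rule integrable_torus_bounded[of _ _ 1]) (use D in auto)
  have int_fc: "(LINT x|torus. of_real (f x) * chr n x) = 2 * pi * a (- n)" for n
    by (simp add: a_def fourier_coeff_chr)
  have cnj_a: "cnj (a n) = a (- n)" for n
  proof -
    have "cnj (a n) = 1 / (2 * pi) * (LINT x|torus. cnj (of_real (f x) * chr (- n) x))"
      by (simp add: a_def fourier_coeff_chr del: complex_cnj_mult) simp
    then show ?thesis
      by (simp add: a_def fourier_coeff_chr exp_cnj)
  qed
  have eq: "g x * cnj (g x) = of_real ((f x)\<^sup>2) - (\<Sum>n\<in>A. a n * (of_real (f x) * chr n x))
      - (\<Sum>n\<in>A. cnj (a n) * (of_real (f x) * chr (- n) x))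
      + (\<Sum>n\<in>A. \<Sum>m\<in>A. a n * cnj (a m) * chr (n - m) x)" for x
  proof -
    have *: "(\<Sum>n\<in>A. a n * chr n x) * (\<Sum>m\<in>A. cnj (a m) * chr (- m) x)
       = (\<Sum>n\<in>A. \<Sum>m\<in>A. a n * cnj (a m) * chr (n - m) x)"
      unfolding sum_product
      by (intro sum.cong refl) (simp add: exp_diff exp_minus field_simps)
    have c: "cnj (g x) = of_real (f x) - (\<Sum>n\<in>A. cnj (a n) * chr (- n) x)"
      by (simp add: g_def exp_cnj)
    have **: "of_real (f x) * (\<Sum>n\<in>A. b n * h n) = (\<Sum>n\<in>A. b n * (of_real (f x) * h n))"
      for b h :: "int \<Rightarrow> complex"
      by (simp add: sum_distrib_left mult_ac)
    show ?thesis
      unfolding c *[symmetric] **[symmetric] by (simp add: g_def power2_eq_square ring_distribs mult.commute)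
  qed
  have "(LINT x|torus. g x * cnj (g x)) = (LINT x|torus. of_real ((f x)\<^sup>2))
      - (\<Sum>n\<in>A. a n * (2 * pi * a (- n))) - (\<Sum>n\<in>A. cnj (a n) * (2 * pi * a n))
      + (\<Sum>n\<in>A. \<Sum>m\<in>A. a n * cnj (a m) * (if n - m = 0 then 2 * pi else 0))"
    unfolding eq using D(2) int_f integrable_chr
    by (simp add: Bochner_Integration.integral_sum Bochner_Integration.integral_diff Bochner_Integration.integral_add
      int_fc[of "- _", simplified] int_fc integral_chr[of "_ - _", simplified] del: of_real_power of_int_diff of_int_minus)
      (simp only: integral_chr right_minus_eq)
  also have "\<dots> = (LINT x|torus. of_real ((f x)\<^sup>2)) - (\<Sum>n\<in>A. a n * (2 * pi * cnj (a n)))"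
  proof -
    have "(\<Sum>m\<in>A. a n * cnj (a m) * (if n - m = 0 then 2 * pi else 0)) = a n * (2 * pi * cnj (a n))"
      if "n \<in> A" for n
    proof -
      have "(\<Sum>m\<in>A. a n * cnj (a m) * (if n - m = 0 then 2 * pi else 0))
        = (\<Sum>m\<in>A. if n = m then a n * cnj (a m) * (2 * pi) else 0)"
        by (intro sum.cong) auto
      also have "\<dots> = a n * (2 * pi * cnj (a n))"
        using assms(2) that by (subst sum.delta') (auto simp: mult_ac)
      finally show ?thesis .
    qed
    then show ?thesis
      by (simp add: cnj_a mult_ac)
  qed
  also have "\<dots> = of_real ((LINT x|torus. (f x)\<^sup>2) - 2 * pi * S)"
    by (simp add: S_def sum_distrib_left complex_norm_square mult_ac del: of_real_power)
  finally have "(LINT x|torus. complex_of_real ((cmod (g x))\<^sup>2)) = of_real ((LINT x|torus. (f x)\<^sup>2) - 2 * pi * S)"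
    by (simp add: complex_norm_square del: of_real_power)
  then have "(LINT x|torus. (cmod (g x))\<^sup>2) = (LINT x|torus. (f x)\<^sup>2) - 2 * pi * S"
    by (metis integral_complex_of_real of_real_eq_iff)
  moreover have "0 \<le> (LINT x|torus. (cmod (g x))\<^sup>2)"
    by simp
  ultimately have "2 * pi * S \<le> (LINT x|torus. (f x)\<^sup>2)"
    by linarith
  then show ?thesis
    unfolding S_def a_def by (simp add: field_simps)
qed

lemma continuous_circle_bounded:
  fixes g :: "complex \<Rightarrow> real"
  assumes "continuous_on UNIV g"
  obtains B where "\<And>x. norm (complex_of_real (g (cis x))) \<le> B"
proof -
  have "compact (g ` sphere 0 1)"
    using assms by (intro compact_continuous_image) (auto intro: continuous_on_subset)
  then obtain B where "\<And>y. y \<in> g ` sphere 0 1 \<Longrightarrow> norm y \<le> B"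
    using compact_imp_bounded bounded_iff by metis
  then show ?thesis
    by (intro that[of B]) auto
qed

lemma continuous_circle_measurable:
  fixes g :: "complex \<Rightarrow> real"
  assumes "continuous_on UNIV g"
  shows "(\<lambda>x. g (cis x)) \<in> borel_measurable torus"
  by (intro borel_imp_torus borel_measurable_continuous_onI continuous_on_compose2[OF assms] continuous_intros) auto

lemma continuous_circle_integrable:
  fixes g :: "complex \<Rightarrow> real"
  assumes "continuous_on UNIV g" "integrable torus F"
  shows "integrable torus (\<lambda>x. F x * complex_of_real (g (cis x)))"
proof -
  obtain B where "\<And>x. norm (complex_of_real (g (cis x))) \<le> B"
    using continuous_circle_bounded[OF assms(1)] by blast
  then show ?thesis
    using continuous_circle_measurable[OF assms(1)] assms(2)
    by (intro integrable_torus_bounded[of _ _ B]) auto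
qed

lemma orth_polynomial:
  fixes g :: "complex \<Rightarrow> real"
  assumes "real_polynomial_function g" "integrable torus F"
    "\<And>n. (LINT x|torus. F x * chr n x) = 0"
  shows "(LINT x|torus. (F x * of_real (g (cis x))) * chr n x) = 0"
  using assms
proof (induction arbitrary: F n rule: real_polynomial_function.induct)
  case (linear f)
  note prems = linear.prems
  from linear.hyps interpret bounded_linear f .
  have int: "integrable torus (\<lambda>x. F x * chr n x)" for n
    by (rule integrable_torus_bounded[of _ _ 1]) (use prems in auto)
  define \<alpha> \<beta> where "\<alpha> = (of_real (f 1) - \<i> * of_real (f \<i>)) / 2" and "\<beta> = (of_real (f 1) + \<i> * of_real (f \<i>)) / 2"
  have "of_real (f (cis x)) = \<alpha> * chr 1 x + \<beta> * chr (-1) x" for x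
  proof -
    have "cis x = cos x *\<^sub>R 1 + sin x *\<^sub>R \<i>"
      by (simp add: complex_eq_iff)
    then have "f (cis x) = cos x * f 1 + sin x * f \<i>"
      by (metis add scale real_scaleR_def)
    moreover have "chr 1 x = cis x" "chr (-1) x = cis (- x)"
      by (simp_all add: cis_conv_exp)
    ultimately show ?thesis
      unfolding \<alpha>_def \<beta>_def by (simp add: complex_eq_iff field_simps)
  qed
  then have e: "(F x * of_real (f (cis x))) * chr n x = \<alpha> * (F x * chr (1 + n) x) + \<beta> * (F x * chr (-1 + n) x)" for x
    by (simp only: chr_mult[symmetric]) (simp only: ring_distribs mult_ac)
  have "(LINT x|torus. \<alpha> * (F x * chr k x) + \<beta> * (F x * chr l x)) = 0" for k l
    using int prems by simp
  then show ?case
    unfolding e .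
next
  case (const c)
  then show ?case by (simp add: mult.commute[of _ "complex_of_real c"] mult.assoc)
next
  case (add f g)
  have "integrable torus (\<lambda>x. (F x * of_real (h (cis x))) * chr n x)" if "real_polynomial_function h" for h :: "complex \<Rightarrow> real"
    by (rule integrable_torus_bounded[of _ _ 1])
      (use add that in \<open>auto intro!: continuous_circle_integrable continuous_on_polymonial_function simp: real_polynomial_function_eq\<close>)
  then show ?case
    using add by (simp add: ring_distribs)
next
  case (mult f g)
  have "integrable torus (\<lambda>x. F x * of_real (f (cis x)))"
    using mult by (auto intro!: continuous_circle_integrable continuous_on_polymonial_function simp: real_polynomial_function_eq)
  from mult.IH(2)[OF this mult.IH(1)[OF mult.prems]] show ?case
    by (simp add: mult_ac)
qed

lemma orth_continuous:
  fixes g :: "complex \<Rightarrow> real"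
  assumes "continuous_on UNIV g" "integrable torus F"
    "\<And>n. (LINT x|torus. F x * chr n x) = 0"
  shows "(LINT x|torus. F x * of_real (g (cis x))) = 0"
proof -
  let ?I = "LINT x|torus. F x * of_real (g (cis x))" and ?N = "LINT x|torus. norm (F x)"
  have N: "0 \<le> ?N" by simp
  have "norm ?I \<le> 0 + e" if "0 < e" for e
  proof -
    define d where "d = e / (?N + 1)"
    have "d > 0" unfolding d_def using that N by (intro divide_pos_pos) linarith+
    obtain q where q: "real_polynomial_function q" "\<And>x. x \<in> sphere (0::complex) 1 \<Longrightarrow> \<bar>g x - q x\<bar> < d"
      using Stone_Weierstrass_real_polynomial_function[of "sphere (0::complex) 1" g d] \<open>d > 0\<close> assms(1)
      by (auto intro: continuous_on_subset)
    have cq: "continuous_on UNIV q"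
      using q by (auto intro!: continuous_on_polymonial_function simp: real_polynomial_function_eq)
    have cd: "continuous_on UNIV (\<lambda>x. g x - q x)"
      using cq assms by (intro continuous_intros)
    have "?I = (LINT x|torus. F x * of_real (g (cis x) - q (cis x)))"
      using orth_polynomial[OF q(1) assms(2,3), of 0] continuous_circle_integrable[OF assms(1,2)]
        continuous_circle_integrable[OF cq assms(2)] by (simp add: ring_distribs)
    also have "norm \<dots> \<le> (LINT x|torus. norm (F x * of_real (g (cis x) - q (cis x))))"
      by (rule integral_norm_bound)
    also have "\<dots> \<le> (LINT x|torus. norm (F x) * d)"
    proof (rule integral_mono)
      show "integrable torus (\<lambda>x. norm (F x * of_real (g (cis x) - q (cis x))))"
        using continuous_circle_integrable[OF cd assms(2)] by (rule integrable_norm)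
      show "integrable torus (\<lambda>x. norm (F x) * d)" using assms(2) by simp
      show "norm (F x * of_real (g (cis x) - q (cis x))) \<le> norm (F x) * d" for x
        using q(2)[of "cis x"] by (auto simp: norm_mult simp del: of_real_diff intro!: mult_left_mono)
    qed
    also have "\<dots> = ?N * d" by simp
    also have "\<dots> \<le> (?N + 1) * d"
      using \<open>d > 0\<close> by simp
    also have "\<dots> = e"
    proof -
      have "?N + 1 \<noteq> 0" using N by linarith
      then show ?thesis by (simp add: d_def)
    qed
    finally show ?thesis by simp
  qed
  then have "norm ?I \<le> 0" by (rule field_le_epsilon)
  then show ?thesis by simp
qed

lemma cis_inj_torus:
  assumes "cis x = cis y" "0 \<le> x" "x < 2 * pi" "0 \<le> y" "y < 2 * pi"
  shows "x = y"
proof -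
  have "sin x = sin y \<and> cos x = cos y"
    using assms(1) by (auto simp: complex_eq_iff)
  then obtain n :: int where n: "x = y + 2 * pi * n"
    by (auto simp: sin_cos_eq_iff)
  have "-1 < n" "n < 1"
  proof -
    have "2 * pi * real_of_int n < 2 * pi * 1" "2 * pi * (-1) < 2 * pi * real_of_int n" using n assms by linarith+
    then have "real_of_int n < 1" "-1 < real_of_int n" 
      using mult_less_cancel_left_pos[of "2*pi"] pi_gt_zero by (metis mult_pos_pos zero_less_numeral)+
    then show "-1 < n" "n < 1" by linarith+
  qed
  then have "n = 0" by simp
  with n show ?thesis by simp
qed

lemma orth_arc:
  assumes "integrable torus F" "\<And>n. (LINT x|torus. F x * chr n x) = 0"
  shows "(LINT x|torus. F x * indicator {a<..} x) = 0"
proof -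
  consider "a < 0" | "0 \<le> a" "a < 2 * pi" | "2 * pi \<le> a" by linarith
  then show ?thesis
  proof cases
    case 1
    then have "(LINT x|torus. F x * indicator {a<..} x) = (LINT x|torus. F x * chr 0 x)"
      by (intro Bochner_Integration.integral_cong) auto
    then show ?thesis using assms by metis
  next
    case 3
    then have "(LINT x|torus. F x * indicator {a<..} x) = (LINT x|torus. 0)"
      by (intro Bochner_Integration.integral_cong) auto
    then show ?thesis by simp
  next
    case 2
    define K where "K = cis ` {0..a}"
    have K: "closed K" "K \<noteq> {}"
      using 2 unfolding K_def by (auto intro!: compact_imp_closed compact_continuous_image continuous_intros)
    define h where "h = (\<lambda>k::nat. \<lambda>z. min 1 (real k * infdist z K))"
    have ch: "continuous_on UNIV (h k)" for k
      unfolding h_def by (intro continuous_intros)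
    have "(\<lambda>k. LINT x|torus. F x * of_real (h k (cis x))) \<longlonglongrightarrow> (LINT x|torus. F x * indicator {a<..} x)"
    proof (rule integral_dominated_convergence[where w = "\<lambda>x. norm (F x)"])
      note [measurable] = borel_measurable_integrable[OF assms(1)] continuous_circle_measurable[OF ch]
      show "(\<lambda>x. F x * indicator {a<..} x) \<in> borel_measurable torus"
        by (intro borel_measurable_times borel_measurable_integrable[OF assms(1)] borel_imp_torus) auto
      show "(\<lambda>x. F x * of_real (h k (cis x))) \<in> borel_measurable torus" for k
        by measurable
      show "integrable torus (\<lambda>x. norm (F x))" using assms by simp
      show "AE x in torus. norm (F x * of_real (h k (cis x))) \<le> norm (F x)" for k
        by (intro AE_I2) (auto simp: norm_mult h_def infdist_nonneg intro!: mult_left_le)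
      show "AE x in torus. (\<lambda>k. F x * of_real (h k (cis x))) \<longlonglongrightarrow> F x * indicator {a<..} x"
      proof (intro AE_I2 tendsto_mult tendsto_const)
        fix x assume x: "x \<in> space torus"
        show "(\<lambda>k. complex_of_real (h k (cis x))) \<longlonglongrightarrow> indicator {a<..} x"
        proof (cases "a < x")
          case False
          then have "cis x \<in> K" using x by (auto simp: K_def)
          then show ?thesis using False by (simp add: h_def)
        next
          case True
          have "cis x \<notin> K"
            using cis_inj_torus[of x] x True 2 by (fastforce simp: K_def)
          then have pos: "0 < infdist (cis x) K"
            using K in_closed_iff_infdist_zero[OF K] infdist_nonneg[of "cis x" K] by (metis order_le_less)
          obtain m :: nat where m: "1 / infdist (cis x) K < m"
            using reals_Archimedean2 by blast
          have "h k (cis x) = 1" if "m \<le> k" for k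
          proof -
            have "1 / infdist (cis x) K \<le> real k" using m that by linarith
            then show ?thesis using pos by (simp add: h_def field_simps)
          qed
          then have "\<forall>\<^sub>F k in sequentially. complex_of_real (h k (cis x)) = indicator {a<..} x"
            using True by (auto simp: eventually_sequentially)
          then show ?thesis by (rule tendsto_eventually)
        qed
      qed
    qed
    then show ?thesis
      using orth_continuous[OF ch assms] by (simp add: LIMSEQ_const_iff)
  qed
qed

lemma fourier_coeff_unique:
  assumes f: "f \<in> L2_mean_zero" and 0: "\<And>n. fourier_coeff f n = 0"
  shows "AE x in torus. f x = 0"
proof -
  note D = L2_mean_zeroD[OF f]
  define F where "F = (\<lambda>x. f x * indicator {0..<2 * pi} x)"
  have F_meas [measurable]: "F \<in> borel_measurable lborel"
    using D(1) unfolding torus_def F_def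
    by (subst (asm) borel_measurable_restrict_space_iff) (auto simp: mult.commute)
  have F_int: "integrable lborel F"
    using D(3) unfolding torus_def F_def
    by (subst (asm) integrable_restrict_space) (auto simp: mult.commute)
  have "(LINT x|torus. of_real (f x) * chr n x) = 0" for n
    using 0[of "- n"] by (simp add: fourier_coeff_chr)
  then have "(LINT x|torus. complex_of_real (f x) * indicator {a<..} x) = 0" for a
    using D(3) by (intro orth_arc) auto
  then have "complex_of_real (LINT x|torus. f x * indicator {a<..} x) = 0" for a
    unfolding integral_complex_of_real[symmetric] of_real_mult of_real_indicator .
  then have arc: "(LINT x|lborel. F x * indicator {a<..} x) = 0" for a
    unfolding torus_def F_def by (subst (asm) integral_restrict_space) (auto simp: mult_ac)
  have arc_int: "integrable lborel (\<lambda>x. F x * indicator {a<..} x)" for a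
    using F_int by (intro integrable_real_mult_indicator) auto
  have em: "emeasure (density lborel (\<lambda>x. ennreal (G x))) {a<..} = (\<integral>\<^sup>+x. ennreal (G x * indicator {a<..} x) \<partial>lborel)"
    if "G \<in> borel_measurable lborel" for G :: "real \<Rightarrow> real" and a
    proof -
    have "emeasure (density lborel (\<lambda>x. ennreal (G x))) {a<..} = (\<integral>\<^sup>+x. ennreal (G x) * indicator {a<..} x \<partial>lborel)"
      using that by (intro emeasure_density) (auto simp: borel_open)
    then show ?thesis
      by (auto intro!: nn_integral_cong simp: indicator_def)
  qed
  have "density lborel (\<lambda>x. ennreal (F x)) = density lborel (\<lambda>x. ennreal (- F x))"
  proof (rule measure_eqI_lessThan)
    fix a
    have fin: "(\<integral>\<^sup>+x. ennreal (F x * indicator {a<..} x) \<partial>lborel) < \<infinity>"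
      "(\<integral>\<^sup>+x. ennreal (- F x * indicator {a<..} x) \<partial>lborel) < \<infinity>"
      using arc_int[of a] by (auto simp: real_integrable_def less_top)
    show "emeasure (density lborel (\<lambda>x. ennreal (F x))) {a<..} < \<infinity>"
      using fin by (simp add: em)
    show "emeasure (density lborel (\<lambda>x. ennreal (F x))) {a<..} = emeasure (density lborel (\<lambda>x. ennreal (- F x))) {a<..}"
    proof -
      have "enn2real (\<integral>\<^sup>+x. ennreal (F x * indicator {a<..} x) \<partial>lborel)
          = enn2real (\<integral>\<^sup>+x. ennreal (- F x * indicator {a<..} x) \<partial>lborel)"
        using arc[of a] unfolding real_lebesgue_integral_def[OF arc_int] by simp
      then have "(\<integral>\<^sup>+x. ennreal (F x * indicator {a<..} x) \<partial>lborel)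
          = (\<integral>\<^sup>+x. ennreal (- F x * indicator {a<..} x) \<partial>lborel)"
        using fin by (metis ennreal_enn2real infinity_ennreal_def)
      then show ?thesis
        by (subst (1 2) em) auto
    qed
  qed auto
  then have "AE x in lborel. ennreal (F x) = ennreal (- F x)"
    by (intro sigma_finite_measure.density_unique[OF sigma_finite_lborel]) auto
  then have "AE x in lborel. F x = 0"
  proof eventually_elim
    case (elim x)
    have "F x = 0" if "ennreal (F x) = ennreal (- F x)"
    proof (cases "0 \<le> F x")
      case True
      then have "ennreal (F x) = 0" using that by (simp add: ennreal_neg)
      then show ?thesis using True by (simp add: ennreal_eq_0_iff)
    next
      case False
      then have "ennreal (- F x) = 0" using that by (simp add: ennreal_neg)
      then show ?thesis using False by (simp add: ennreal_eq_0_iff)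
    qed
    with elim show ?case by blast
  qed
  then show ?thesis
    unfolding torus_def by (subst AE_restrict_space_iff) (auto simp: F_def elim!: eventually_mono)
qed


lemma fourier_zero [simp]: "fourier 0 n = 0"
  by transfer (simp add: fourier_coeff_def)

lemma fourier_add: "fourier (f + g) n = fourier f n + fourier g n"
proof (transfer fixing: n)
  fix f g :: "real \<Rightarrow> real"
  assume fg: "f \<in> L2_mean_zero \<and> f \<in> L2_mean_zero \<and> (AE x in torus. f x = f x)"
    "g \<in> L2_mean_zero \<and> g \<in> L2_mean_zero \<and> (AE x in torus. g x = g x)"
  have "integrable torus (\<lambda>x. of_real (h x) * chr (- n) x)" if "h \<in> L2_mean_zero" for h
    using L2_mean_zeroD(3)[OF that] by (intro integrable_torus_bounded[of _ _ 1]) auto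
  then show "fourier_coeff (\<lambda>x. f x + g x) n = fourier_coeff f n + fourier_coeff g n"
    unfolding fourier_coeff_chr using fg by (simp add: ring_distribs)
qed

lemma fourier_scaleR: "fourier (c *\<^sub>R f) n = of_real c * fourier f n"
  by transfer (simp add: fourier_coeff_def mult.assoc)

lemma fourier_minus_index: "fourier f (- n) = cnj (fourier f n)"
proof (transfer fixing: n)
  fix f :: "real \<Rightarrow> real"
  have "cnj (fourier_coeff f n) = 1 / (2 * pi) * (LINT x|torus. cnj (of_real (f x) * chr (- n) x))"
    by (simp add: fourier_coeff_chr del: complex_cnj_mult) simp
  then show "fourier_coeff f (- n) = cnj (fourier_coeff f n)"
    by (simp add: fourier_coeff_chr exp_cnj)
qed

lemma fourier_zero_index: "fourier f 0 = 0"
proof transfer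
  fix f :: "real \<Rightarrow> real"
  assume "f \<in> L2_mean_zero \<and> f \<in> L2_mean_zero \<and> (AE x in torus. f x = f x)"
  then have "(LINT x|torus. complex_of_real (f x)) = 0"
    using L2_mean_zeroD(4)[of f] by simp
  then show "fourier_coeff f 0 = 0"
    by (simp add: fourier_coeff_def)
qed

lemma fourier_unique:
  assumes "\<And>n. 0 < n \<Longrightarrow> fourier f n = 0"
  shows "f = 0"
proof -
  have "fourier f n = 0" for n
    using assms[of n] assms[of "- n"] fourier_zero_index[of f] fourier_minus_index[of f n]
    by (cases n "0 :: int" rule: linorder_cases) auto
  then show ?thesis
    by transfer (auto intro: fourier_coeff_unique L2_mean_zero_zero)
qed

lemma summable_fourier_sq: "summable (\<lambda>n. (cmod (fourier f (int (Suc n))))\<^sup>2)"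
proof transfer
  fix f :: "real \<Rightarrow> real"
  assume "f \<in> L2_mean_zero \<and> f \<in> L2_mean_zero \<and> (AE x in torus. f x = f x)"
  then have f: "f \<in> L2_mean_zero" by simp
  show "summable (\<lambda>n. (cmod (fourier_coeff f (int (Suc n))))\<^sup>2)"
  proof (rule summableI_nonneg_bounded)
    fix n
    have "(\<Sum>k<n. (cmod (fourier_coeff f (int (Suc k))))\<^sup>2)
        = (\<Sum>m\<in>(\<lambda>k. int (Suc k)) ` {..<n}. (cmod (fourier_coeff f m))\<^sup>2)"
      by (subst sum.reindex) (auto simp: inj_on_def)
    also have "\<dots> \<le> 1 / (2 * pi) * (LINT x|torus. (f x)\<^sup>2)"
      by (intro bessel_torus f) auto
    finally show "(\<Sum>k<n. (cmod (fourier_coeff f (int (Suc k))))\<^sup>2)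
        \<le> 1 / (2 * pi) * (LINT x|torus. (f x)\<^sup>2)" .
  qed simp
qed

lemma summable_fourier_inner:
  "summable (\<lambda>n. Re (fourier f (int (Suc n)) * cnj (fourier g (int (Suc n)))))"
proof (rule summable_comparison_test')
  show "summable (\<lambda>n. (cmod (fourier f (int (Suc n))))\<^sup>2 + (cmod (fourier g (int (Suc n))))\<^sup>2)"
    by (intro summable_add summable_fourier_sq)
  have "\<bar>Re (z * cnj w)\<bar> \<le> (cmod z)\<^sup>2 + (cmod w)\<^sup>2" for z w
  proof -
    have "\<bar>Re (z * cnj w)\<bar> \<le> cmod z * cmod w"
      using abs_Re_le_cmod[of "z * cnj w"] by (simp add: norm_mult)
    also have "\<dots> \<le> (cmod z)\<^sup>2 + (cmod w)\<^sup>2"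
      using sum_squares_bound[of "cmod z" "cmod w"] mult_nonneg_nonneg[of "cmod z" "cmod w"]
      by (simp del: mult_nonneg_nonneg)
    finally show ?thesis .
  qed
  then show "norm (Re (fourier f (int (Suc n)) * cnj (fourier g (int (Suc n)))))
      \<le> (cmod (fourier f (int (Suc n))))\<^sup>2 + (cmod (fourier g (int (Suc n))))\<^sup>2" for n
    unfolding real_norm_def .
qed

text \<open>The norm is \<open>\<parallel>f\<parallel>\<^sup>2 = (\<Sum>n\<ge>1. \<bar>a\<^sub>n\<bar>\<^sup>2)\<close>, that is \<open>1 / (4 * pi)\<close> times the usual squared \<open>L\<^sup>2\<close> norm;
  the inner product is its polarization.\<close>

instantiation mean_zero_L2 :: real_inner
begin

definition norm_mean_zero_L2 :: "mean_zero_L2 \<Rightarrow> real" where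
  "norm f = sqrt (\<Sum>n. (cmod (fourier f (int (Suc n))))\<^sup>2)"

definition inner_mean_zero_L2 :: "mean_zero_L2 \<Rightarrow> mean_zero_L2 \<Rightarrow> real" where
  "inner f g = (\<Sum>n. Re (fourier f (int (Suc n)) * cnj (fourier g (int (Suc n)))))"

definition sgn_mean_zero_L2_def: "sgn (f :: mean_zero_L2) = inverse (norm f) *\<^sub>R f"

definition dist_mean_zero_L2_def: "dist f g = norm (f - g :: mean_zero_L2)"

definition uniformity_mean_zero_L2 :: "(mean_zero_L2 \<times> mean_zero_L2) filter" where
  "uniformity_mean_zero_L2 = (INF e\<in>{0<..}. principal {(f, g). dist f g < e})"

definition open_mean_zero_L2 :: "mean_zero_L2 set \<Rightarrow> bool" where
  "open_mean_zero_L2 U = (\<forall>f\<in>U. \<forall>\<^sub>F (g, h) in uniformity. g = f \<longrightarrow> h \<in> U)"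

instance
proof
  fix f g h :: mean_zero_L2 and c :: real and U :: "mean_zero_L2 set"
  show "dist f g = norm (f - g)" by (rule dist_mean_zero_L2_def)
  show "sgn f = inverse (norm f) *\<^sub>R f" by (rule sgn_mean_zero_L2_def)
  show "uniformity = (INF e\<in>{0<..}. principal {(f :: mean_zero_L2, g). dist f g < e})"
    by (rule uniformity_mean_zero_L2_def)
  show "open U = (\<forall>f\<in>U. \<forall>\<^sub>F (g, h) in uniformity. g = f \<longrightarrow> h \<in> U)"
    by (rule open_mean_zero_L2_def)
  show "inner f g = inner g f"
    by (simp add: inner_mean_zero_L2_def mult.commute)
  show "inner (f + g) h = inner f h + inner g h"
    unfolding inner_mean_zero_L2_def
    by (subst suminf_add[OF summable_fourier_inner summable_fourier_inner])
      (simp only: fourier_add ring_distribs plus_complex.sel)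
  show "inner (c *\<^sub>R f) g = c * inner f g"
    unfolding inner_mean_zero_L2_def
    by (subst suminf_mult[OF summable_fourier_inner, symmetric])
      (simp add: fourier_scaleR mult.assoc algebra_simps)
  have ff: "inner f f = (\<Sum>n. (cmod (fourier f (int (Suc n))))\<^sup>2)"
    unfolding inner_mean_zero_L2_def complex_mult_cnj cmod_power2 by simp
  show "0 \<le> inner f f"
    unfolding ff by (intro suminf_nonneg summable_fourier_sq) auto
  show "norm f = sqrt (inner f f)"
    by (simp add: ff norm_mean_zero_L2_def)
  show "inner f f = 0 \<longleftrightarrow> f = 0"
  proof
    assume "inner f f = 0"
    then have "fourier f (int (Suc n)) = 0" for n
      unfolding ff using suminf_eq_zero_iff[OF summable_fourier_sq[of f]] by simp
    then show "f = 0"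
      by (intro fourier_unique) (metis gr0_implies_Suc zero_less_imp_eq_int)
  qed (simp add: inner_mean_zero_L2_def)
qed

end

section \<open>The Fourier-Besov norm\<close>

definition japanese_bracket :: "int \<Rightarrow> real" where
  "japanese_bracket n = 1 + \<bar>real_of_int n\<bar>"

definition dyadic_block :: "nat \<Rightarrow> int set" where
  "dyadic_block j = {n. 2 ^ j \<le> \<bar>n\<bar> \<and> \<bar>n\<bar> < 2 ^ (j + 1)}"

definition fourier_besov_norm :: "real \<Rightarrow> real \<Rightarrow> mean_zero_L2 \<Rightarrow> ennreal" where
  "fourier_besov_norm s p f =
     (SUP j. ennreal ((\<Sum>n\<in>dyadic_block j.
        japanese_bracket n powr (s * p) * cmod (fourier f n) powr p) powr (1 / p)))"

section \<open>Gauss measure and measurable seminorms\<close>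

definition findim_projections :: "('a::real_inner \<Rightarrow> 'a) set" where
  "findim_projections = {P. linear P \<and> P \<circ> P = P \<and> (\<forall>x y. inner (P x) y = inner x (P y)) \<and>
     (\<exists>B. finite B \<and> range P = span B)}"

definition orthonormal_basis :: "'a::real_inner set \<Rightarrow> 'a set \<Rightarrow> bool" where
  "orthonormal_basis V B \<longleftrightarrow>
     finite B \<and> pairwise orthogonal B \<and> (\<forall>b\<in>B. norm b = 1) \<and> span B = V"

text \<open>Lebesgue measure on a finite-dimensional subspace is transported from the coordinates with
  respect to an orthonormal basis; by rotation invariance the choice of the basis is immaterial.\<close>

definition subspace_lebesgue :: "'a::real_inner set \<Rightarrow> 'a measure" where
  "subspace_lebesgue V = (let B = SOME B. orthonormal_basis V B in
     distr (\<Pi>\<^sub>M b\<in>B. lborel) (restrict_space borel V) (\<lambda>t. \<Sum>b\<in>B. t b *\<^sub>R b))"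

definition cylinder_repr :: "('a::real_inner \<Rightarrow> 'a) \<Rightarrow> 'a set \<Rightarrow> 'a set \<Rightarrow> bool" where
  "cylinder_repr P F E \<longleftrightarrow>
     P \<in> findim_projections \<and> F \<in> sets (restrict_space borel (range P)) \<and> E = {x. P x \<in> F}"

text \<open>The defining formula does not depend on the representation of the cylinder set \<open>E\<close>;
  \<open>gauss_measure E\<close> is meaningful only if \<open>E\<close> is a cylinder set.\<close>

definition gauss_measure :: "'a::real_inner set \<Rightarrow> real" where
  "gauss_measure E = (THE m. \<exists>P F. cylinder_repr P F E \<and>
     m = (2 * pi) powr (- real (dim (range P)) / 2) *
       (LINT x:F|subspace_lebesgue (range P). exp (- (norm x)\<^sup>2 / 2)))"

text \<open>The values are taken in \<open>ennreal\<close> so that a supremum is never silently undefined; finiteness is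
  part of the definition.\<close>

definition seminorm :: "('a::real_vector \<Rightarrow> ennreal) \<Rightarrow> bool" where
  "seminorm N \<longleftrightarrow> (\<forall>x. N x < \<infinity>) \<and> (\<forall>x y. N (x + y) \<le> N x + N y) \<and>
     (\<forall>c x. N (c *\<^sub>R x) = ennreal \<bar>c\<bar> * N x)"

text \<open>A seminorm is continuous on the finite-dimensional space \<open>range P\<close>, so the set below is a
  cylinder set.\<close>

definition measurable_seminorm :: "('a::real_inner \<Rightarrow> ennreal) \<Rightarrow> bool" where
  "measurable_seminorm N \<longleftrightarrow> seminorm N \<and>
     (\<forall>\<epsilon>>0. \<exists>P\<^sub>0\<in>findim_projections. \<forall>P\<in>findim_projections.
        (\<forall>x y. inner (P x) (P\<^sub>0 y) = 0) \<longrightarrow>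
        gauss_measure {x. ennreal \<epsilon> < N (P x)} < \<epsilon>)"


end

theory Submission
  imports Defs "HOL-Probability.Probability"
begin

text \<open>
  Let \<open>P\<^sub>0\<close> be the projection onto the frequencies below \<open>2 ^ J\<close>. If \<open>P\<close> is orthogonal to \<open>P\<^sub>0\<close>, the
  functions in the range of \<open>P\<close> have no Fourier coefficients in the dyadic blocks with index below
  \<open>J\<close>. Under the standard Gaussian on this range every Fourier coefficient is a Gaussian variable
  whose variance is bounded independently of \<open>P\<close>, by Bessel's inequality. Hence its \<open>p\<close>-th absolute
  moment is bounded by a constant (\<open>fourier_moment_le\<close>), and the expectation of the sum of
  \<open>\<langle>n\<rangle> powr (s * p) * \<bar>a\<^sub>n\<bar> powr p\<close> over the block \<open>\<bar>n\<bar> \<sim> 2 ^ j\<close> is at most a constant times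
  \<open>r ^ j\<close> with \<open>r = 2 powr (1 + s * p) < 1\<close>. These bounds are summable in \<open>j\<close>, so by Markov's
  inequality the probability that some block exceeds \<open>\<epsilon>\<close> is at most a constant times \<open>r ^ J\<close>
  (\<open>fourier_besov_tail_le\<close>). A large \<open>J\<close> makes this smaller than \<open>\<epsilon>\<close>.

  The moment bound avoids the distribution of the coefficients: \<open>x powr p\<close> is dominated by a multiple
  of \<open>exp x\<close>, and the integral of \<open>exp \<langle>x, v\<rangle>\<close> factors over the coordinates of an orthonormal basis
  (\<open>nn_integral_exp_inner_le\<close>).

  For this argument the Gauss measure of a cylinder set has to be identified with the mass under an
  honest probability measure, the image of a product of standard normal distributions. This requires
  that the defining integral does not depend on the orthonormal basis, nor on the representation of
  the cylinder set. The first is rotation invariance, proved by Fubini's theorem and translation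
  invariance (\<open>lebesgue_unique_up_to_factor\<close>); the second follows by passing to the sum of the two ranges
  and integrating out the superfluous coordinates (\<open>std_gaussian_cylinder_consistent\<close>).
\<close>

section \<open>Finite orthonormal systems\<close>

abbreviation orthonormal :: "'a::real_inner set \<Rightarrow> bool" where
  "orthonormal B \<equiv> orthonormal_basis (span B) B"

definition lin_comb :: "'a::real_vector set \<Rightarrow> ('a \<Rightarrow> real) \<Rightarrow> 'a" where
  "lin_comb B t = (\<Sum>b\<in>B. t b *\<^sub>R b)"

lemma lin_comb_cong: "(\<And>b. b \<in> B \<Longrightarrow> t b = u b) \<Longrightarrow> lin_comb B t = lin_comb B u"
  by (simp add: lin_comb_def)

lemma lin_comb_add: "lin_comb B (\<lambda>b. t b + u b) = lin_comb B t + lin_comb B u"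
  by (simp add: lin_comb_def scaleR_add_left sum.distrib)

lemma lin_comb_diff: "lin_comb B (\<lambda>b. t b - u b) = lin_comb B t - lin_comb B u"
  by (simp add: lin_comb_def scaleR_diff_left sum_subtractf)

lemma lin_comb_in_span: "lin_comb B t \<in> span B"
  unfolding lin_comb_def by (intro span_sum span_scale span_base)

lemma orthonormalD:
  assumes "orthonormal_basis V B"
  shows "finite B" "span B = V" "orthonormal B"
    "\<And>b c. b \<in> B \<Longrightarrow> c \<in> B \<Longrightarrow> inner b c = (if b = c then 1 else 0)"
  using assms by (auto simp: orthonormal_basis_def pairwise_def orthogonal_def norm_eq_1)

lemma inner_lin_comb:
  assumes "orthonormal_basis V B" "c \<in> B"
  shows "inner (lin_comb B t) c = t c"
proof -
  have "inner (lin_comb B t) c = (\<Sum>b\<in>B. if b = c then t b else 0)"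
    unfolding lin_comb_def inner_sum_left
    by (intro sum.cong) (auto simp: orthonormalD(4)[OF assms(1)] assms(2))
  then show ?thesis
    using assms orthonormalD(1)[OF assms(1)] by simp
qed

lemma lin_comb_inner:
  assumes "orthonormal_basis V B" "x \<in> V"
  shows "lin_comb B (\<lambda>b. inner x b) = x"
proof -
  from assms have "x \<in> span B" by (simp add: orthonormalD)
  then obtain u where x: "x = lin_comb B u"
    using span_finite[OF orthonormalD(1)[OF assms(1)]] by (auto simp: lin_comb_def)
  show ?thesis
    using inner_lin_comb[OF assms(1)] by (subst (2) x, intro lin_comb_cong) (simp add: x)
qed

lemma norm_lin_comb:
  assumes "orthonormal_basis V B"
  shows "(norm (lin_comb B t))\<^sup>2 = (\<Sum>b\<in>B. (t b)\<^sup>2)"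
proof -
  have "(norm (lin_comb B t))\<^sup>2 = inner (lin_comb B t) (lin_comb B t)"
    by (simp add: power2_norm_eq_inner)
  also have "\<dots> = (\<Sum>b\<in>B. t b * inner (lin_comb B t) b)"
    by (subst (2) lin_comb_def) (simp add: inner_sum_right)
  also have "\<dots> = (\<Sum>b\<in>B. (t b)\<^sup>2)"
    by (intro sum.cong) (auto simp: inner_lin_comb[OF assms] power2_eq_square)
  finally show ?thesis .
qed

lemma bessel_orthonormal:
  assumes "orthonormal_basis V B"
  shows "(\<Sum>b\<in>B. (inner v b)\<^sup>2) \<le> (norm v)\<^sup>2"
proof -
  define w where "w = lin_comb B (\<lambda>b. inner v b)"
  have vw: "inner v w = (\<Sum>b\<in>B. (inner v b)\<^sup>2)"
    by (simp add: w_def lin_comb_def inner_sum_right power2_eq_square)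
  have ww: "inner w w = (\<Sum>b\<in>B. (inner v b)\<^sup>2)"
    using norm_lin_comb[OF assms, of "\<lambda>b. inner v b"] by (simp add: w_def power2_norm_eq_inner)
  have "0 \<le> inner (v - w) (v - w)" by simp
  also have "\<dots> = (norm v)\<^sup>2 - (\<Sum>b\<in>B. (inner v b)\<^sup>2)"
    by (simp add: inner_diff vw ww inner_commute[of w v] power2_norm_eq_inner)
  finally show ?thesis by simp
qed

text \<open>Gram-Schmidt orthonormalization of \<open>S\<close>, one vector at a time, relative to the given system \<open>B\<close>.
  Keeping \<open>B\<close> inside the new basis is what later turns a projection into a restriction of
  coordinates.\<close>

lemma orthonormal_extend:
  fixes B :: "'a::real_inner set"
  assumes "orthonormal B" "finite S"
  shows "\<exists>D. orthonormal D \<and> B \<subseteq> D \<and> span D = span (B \<union> S)"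
  using assms(2)
proof induction
  case empty
  then show ?case using assms(1) by auto
next
  case (insert a S)
  then obtain D where D: "orthonormal D" "B \<subseteq> D" "span D = span (B \<union> S)" by blast
  define r where "r = a - lin_comb D (\<lambda>b. inner a b)"
  have span_r: "span (insert r D) = span (B \<union> insert a S)"
  proof -
    have "span (insert r D) = span (insert a D)"
      by (rule eq_span_insert_eq) (simp add: r_def lin_comb_in_span span_neg)
    also have "\<dots> = span (insert a (B \<union> S))"
      using D(3) by (simp add: span_insert)
    finally show ?thesis by simp
  qed
  have orth: "inner r b = 0" if "b \<in> D" for b
    using that by (simp add: r_def inner_diff_left inner_lin_comb[OF D(1)])
  show ?case
  proof (cases "r = 0")
    case True
    then have "span D = span (B \<union> insert a S)"
      using span_r by simp
    then show ?thesis using D by blast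
  next
    case False
    define e where "e = (1 / norm r) *\<^sub>R r"
    have e: "norm e = 1" "\<And>b. b \<in> D \<Longrightarrow> inner e b = 0" "\<And>b. b \<in> D \<Longrightarrow> inner b e = 0"
      using False orth by (auto simp: e_def inner_commute)
    have "r = norm r *\<^sub>R e" using False by (simp add: e_def)
    then have "r \<in> span (insert e D)"
      by (metis insertI1 span_base span_scale)
    moreover have "e \<in> span (insert r D)"
      unfolding e_def by (intro span_scale span_base) simp
    ultimately have "span (insert e D) = span (insert r D)"
      by (intro span_eq[THEN iffD2] conjI subsetI) (auto intro: span_base)
    then have "span (insert e D) = span (B \<union> insert a S)"
      using span_r by simp
    moreover have "orthonormal (insert e D)"
      using D(1) e by (auto simp: orthonormal_basis_def pairwise_insert orthogonal_def)
    ultimately show ?thesis using D(2) by blast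
  qed
qed

lemma orthonormal_basis_exists:
  assumes "finite S"
  obtains B where "orthonormal_basis (span S) B"
proof -
  have "orthonormal {}" by (simp add: orthonormal_basis_def pairwise_empty)
  from orthonormal_extend[OF this assms] show ?thesis
    using that by (auto simp: orthonormal_basis_def)
qed

lemma dim_orthonormal_basis:
  assumes "orthonormal_basis V B"
  shows "dim V = card B"
proof -
  have "independent B"
    using assms by (intro pairwise_orthogonal_independent) (auto simp: orthonormal_basis_def)
  then show ?thesis
    using dim_span_eq_card_independent orthonormalD(2)[OF assms] by metis
qed

text \<open>The ambient space need not be separable, and then sums of measurable functions with
  values in it need not be measurable. The range of \<^term>\<open>lin_comb B\<close> is separable, though: combinations
  with rational coefficients are dense in it, and every open set meets it in a countable union of
  balls around such combinations. The preimage of a ball is given by a polynomial inequality.\<close>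

lemma measurable_lin_comb [measurable]:
  assumes "orthonormal_basis V B"
  shows "lin_comb B \<in> borel_measurable (PiM B (\<lambda>_. borel))"
proof (rule borel_measurableI)
  fix S :: "'a set"
  assume S: "open S"
  note fin = orthonormalD(1)[OF assms]
  define Q :: "('a \<Rightarrow> real) set" where "Q = PiE B (\<lambda>_. \<rat>)"
  have "countable Q"
    unfolding Q_def using fin by (intro countable_PiE countable_rat)
  have dist: "dist (lin_comb B t) (lin_comb B q) = sqrt (\<Sum>b\<in>B. (t b - q b)\<^sup>2)" for t q
    using norm_lin_comb[OF assms, of "\<lambda>b. t b - q b"]
    by (simp add: dist_norm lin_comb_diff real_sqrt_unique)
  define I where "I = {(q, r). q \<in> Q \<and> r \<in> \<rat> \<and> ball (lin_comb B q) r \<subseteq> S}"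
  have "countable I"
    by (rule countable_subset[of _ "Q \<times> \<rat>"]) (use \<open>countable Q\<close> in \<open>auto simp: I_def countable_rat\<close>)
  have dense: "\<exists>q\<in>Q. dist (lin_comb B t) (lin_comb B q) < e" if "0 < e" for t e
  proof -
    have "\<exists>q\<in>\<rat>. \<bar>t b - q\<bar> < e / (1 + card B)" for b
    proof -
      have "t b < t b + e / (1 + card B)"
        using that by simp
      then obtain q where "q \<in> \<rat>" "t b < q" "q < t b + e / (1 + card B)"
        using Rats_dense_in_real by blast
      then show ?thesis by (intro bexI[of _ q]) auto
    qed
    then obtain q where q: "\<And>b. q b \<in> \<rat>" "\<And>b. \<bar>t b - q b\<bar> < e / (1 + card B)"
      by metis
    have "norm (lin_comb B (\<lambda>b. t b - q b)) \<le> (\<Sum>b\<in>B. norm ((t b - q b) *\<^sub>R b))"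
      unfolding lin_comb_def by (rule norm_sum)
    also have "\<dots> \<le> (\<Sum>b\<in>B. e / (1 + card B))"
      using assms q(2) by (intro sum_mono) (auto simp: orthonormal_basis_def less_imp_le)
    also have "\<dots> < e"
      using that by (simp add: field_simps)
    finally have "dist (lin_comb B t) (lin_comb B (restrict q B)) < e"
      by (simp add: dist_norm lin_comb_diff lin_comb_def)
    moreover have "restrict q B \<in> Q" using q by (simp add: Q_def)
    ultimately show ?thesis by blast
  qed
  have "lin_comb B -` S \<inter> space (PiM B (\<lambda>_. borel))
      = (\<Union>(q, r)\<in>I. {t\<in>space (PiM B (\<lambda>_. borel)). dist (lin_comb B t) (lin_comb B q) < r})"
    (is "?L = ?R")
  proof (intro equalityI subsetI)
    fix t assume t: "t \<in> ?L"
    then obtain e where e: "0 < e" "ball (lin_comb B t) e \<subseteq> S"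
      using S open_contains_ball[of S] by (metis IntD1 vimageD)
    obtain r where r: "r \<in> \<rat>" "0 < r" "r < e / 2"
      using Rats_dense_in_real[of 0 "e / 2"] e by auto
    obtain q where q: "q \<in> Q" "dist (lin_comb B t) (lin_comb B q) < r"
      using dense[OF r(2)] by blast
    have "ball (lin_comb B q) r \<subseteq> ball (lin_comb B t) e"
    proof
      fix y assume "y \<in> ball (lin_comb B q) r"
      then show "y \<in> ball (lin_comb B t) e"
        using q(2) r(3) dist_triangle[of "lin_comb B t" y "lin_comb B q"] by simp
    qed
    then have "(q, r) \<in> I" using q r e by (auto simp: I_def)
    then show "t \<in> ?R" using t q by (intro UN_I[of "(q, r)"]) auto
  next
    fix t assume "t \<in> ?R"
    then show "t \<in> ?L" by (auto simp: I_def dist_commute)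
  qed
  moreover have "?R \<in> sets (PiM B (\<lambda>_. borel))"
    unfolding dist using \<open>countable I\<close>
    by (intro sets.countable_UN') (auto simp: case_prod_beta fin)
  ultimately show "lin_comb B -` S \<inter> space (PiM B (\<lambda>_. borel)) \<in> sets (PiM B (\<lambda>_. borel))"
    by simp
qed

section \<open>Rotation invariance\<close>

abbreviation coord_lebesgue :: "'i set \<Rightarrow> ('i \<Rightarrow> real) measure" where
  "coord_lebesgue B \<equiv> PiM B (\<lambda>_. lborel)"

interpretation lborel_prod: product_sigma_finite "\<lambda>_. lborel :: real measure" ..

lemma sets_coord_lebesgue [measurable_cong]: "sets (coord_lebesgue B) = sets (PiM B (\<lambda>_. borel))"
  by (intro sets_PiM_cong) auto

lemma measurable_coord_lebesgue [simp]:
  "measurable (coord_lebesgue B) N = measurable (PiM B (\<lambda>_. borel)) N"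
  by (intro measurable_cong_sets sets_coord_lebesgue refl)

lemma sigma_finite_coord_lebesgue:
  "finite B \<Longrightarrow> sigma_finite_measure (coord_lebesgue B)"
  by (rule lborel_prod.sigma_finite)

text \<open>Each factor is translation invariant, and a product of measures on a finite index set is determined
  by its values on boxes.\<close>

lemma distr_coord_lebesgue_shift:
  assumes "finite B"
  shows "distr (coord_lebesgue B) (coord_lebesgue B) (\<lambda>t. \<lambda>b\<in>B. t b + a b) = coord_lebesgue B"
proof (rule lborel_prod.PiM_eqI[OF assms])
  fix A :: "'a \<Rightarrow> real set"
  assume A: "A b \<in> sets lborel" if "b \<in> B" for b
  have meas: "(\<lambda>t. \<lambda>b\<in>B. t b + a b) \<in> measurable (coord_lebesgue B) (coord_lebesgue B)"
    by measurable
  have shift: "(\<lambda>x. x + a b) -` A b \<in> sets lborel"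
    "emeasure lborel ((\<lambda>x. x + a b) -` A b) = emeasure lborel (A b)" if "b \<in> B" for b
  proof -
    have [measurable]: "A b \<in> sets borel" using A[OF that] by simp
    show "(\<lambda>x. x + a b) -` A b \<in> sets lborel"
      using measurable_sets[of "\<lambda>x. x + a b" borel borel "A b"] by simp
    have "emeasure lborel (A b) = emeasure (distr lborel borel ((+) (a b))) (A b)"
      by (simp add: lborel_distr_plus)
    also have "(+) (a b) = (\<lambda>x. x + a b)"
      by (auto simp: add.commute)
    also have "emeasure (distr lborel borel (\<lambda>x. x + a b)) (A b)
        = emeasure lborel ((\<lambda>x. x + a b) -` A b)"
      by (subst emeasure_distr) auto
    finally show "emeasure lborel ((\<lambda>x. x + a b) -` A b) = emeasure lborel (A b)" ..
  qed
  have "emeasure (distr (coord_lebesgue B) (coord_lebesgue B) (\<lambda>t. \<lambda>b\<in>B. t b + a b)) (PiE B A)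
      = emeasure (coord_lebesgue B) (PiE B (\<lambda>b. (\<lambda>x. x + a b) -` A b))"
    using assms A by (subst emeasure_distr[OF meas])
      (auto intro!: sets_PiM_I_finite arg_cong2[of _ _ _ _ emeasure] simp: space_PiM PiE_iff)
  also have "\<dots> = (\<Prod>b\<in>B. emeasure lborel (A b))"
    using assms shift by (subst lborel_prod.emeasure_PiM) auto
  finally show "emeasure (distr (coord_lebesgue B) (coord_lebesgue B) (\<lambda>t. \<lambda>b\<in>B. t b + a b)) (PiE B A)
      = (\<Prod>b\<in>B. emeasure lborel (A b))" .
qed simp

text \<open>Translation by a vector of the subspace is a translation of the coordinates.\<close>

lemma nn_integral_lin_comb_shift:
  assumes "orthonormal_basis V B" "f \<in> borel_measurable borel" "x \<in> V"
  shows "(\<integral>\<^sup>+t. f (lin_comb B t + x) \<partial>coord_lebesgue B) = (\<integral>\<^sup>+t. f (lin_comb B t) \<partial>coord_lebesgue B)"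
proof -
  note [measurable] = measurable_lin_comb[OF assms(1)] assms(2)
  define s where "s = (\<lambda>t. \<lambda>b\<in>B. t b + inner x b)"
  have s [measurable]: "s \<in> measurable (coord_lebesgue B) (coord_lebesgue B)"
    unfolding s_def by measurable
  have fm: "(\<lambda>t. f (lin_comb B t)) \<in> borel_measurable (coord_lebesgue B)"
    by measurable
  have "lin_comb B (s t) = lin_comb B t + x" for t
  proof -
    have "lin_comb B (s t) = lin_comb B (\<lambda>b. t b + inner x b)"
      by (intro lin_comb_cong) (simp add: s_def)
    then show ?thesis
      by (simp add: lin_comb_add lin_comb_inner[OF assms(1,3)])
  qed
  then have "(\<integral>\<^sup>+t. f (lin_comb B t + x) \<partial>coord_lebesgue B)
      = (\<integral>\<^sup>+t. f (lin_comb B (s t)) \<partial>coord_lebesgue B)"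
    by simp
  also have "\<dots> = (\<integral>\<^sup>+t. f (lin_comb B t) \<partial>distr (coord_lebesgue B) (coord_lebesgue B) s)"
    by (subst nn_integral_distr[OF s]) (use fm in simp_all)
  also have "distr (coord_lebesgue B) (coord_lebesgue B) s = coord_lebesgue B"
    unfolding s_def by (rule distr_coord_lebesgue_shift[OF orthonormalD(1)[OF assms(1)]])
  finally show ?thesis .
qed

text \<open>This is the uniqueness of Haar measure on a finite-dimensional space, for the two Lebesgue measures
  that come from two orthonormal bases. It replaces a change of variables with an orthogonal matrix
  and its determinant. Write the left-hand side as a double integral of \<open>f x * g y\<close> and translate
  three times: \<open>x\<close> to \<open>x + y\<close>, then \<open>y\<close> to \<open>y - x\<close>, and, after exchanging the integrals and
  using that \<open>g\<close> is even, \<open>x\<close> to \<open>x + y\<close> again. This gives \<open>f y * g x\<close>.\<close>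

lemma lebesgue_unique_up_to_factor:
  fixes f g :: "'a::real_inner \<Rightarrow> ennreal"
  assumes B: "orthonormal_basis V B" and C: "orthonormal_basis V C"
    and [measurable]: "f \<in> borel_measurable borel" "g \<in> borel_measurable borel"
    and even: "\<And>x. g (- x) = g x"
  shows "(\<integral>\<^sup>+t. f (lin_comb B t) \<partial>coord_lebesgue B) * (\<integral>\<^sup>+u. g (lin_comb C u) \<partial>coord_lebesgue C)
       = (\<integral>\<^sup>+u. f (lin_comb C u) \<partial>coord_lebesgue C) * (\<integral>\<^sup>+t. g (lin_comb B t) \<partial>coord_lebesgue B)"
proof -
  note [measurable] = measurable_lin_comb[OF B] measurable_lin_comb[OF C]
  let ?LB = "coord_lebesgue B" and ?LC = "coord_lebesgue C"
  interpret LB: sigma_finite_measure ?LB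
    by (rule sigma_finite_coord_lebesgue[OF orthonormalD(1)[OF B]])
  interpret LC: sigma_finite_measure ?LC
    by (rule sigma_finite_coord_lebesgue[OF orthonormalD(1)[OF C]])
  interpret LBC: pair_sigma_finite ?LB ?LC ..
  have inV: "lin_comb B t \<in> V" "lin_comb C u \<in> V" "- lin_comb B t \<in> V" "- lin_comb C u \<in> V" for t u
    using lin_comb_in_span[of B t] lin_comb_in_span[of C u] orthonormalD(2)[OF B] orthonormalD(2)[OF C]
    by (metis span_neg)+
  \<comment> \<open>Joint measurability of the sum is read off from coordinates, since addition need not be
    measurable for the product of the Borel sigma-algebra with itself.\<close>
  have sum_B: "lin_comb B t + lin_comb C u
      = lin_comb B (\<lambda>b\<in>B. t b + (\<Sum>c\<in>C. u c * inner c b))" for t u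
  proof -
    have "lin_comb B (\<lambda>b\<in>B. t b + (\<Sum>c\<in>C. u c * inner c b))
        = lin_comb B (\<lambda>b. t b + inner (lin_comb C u) b)"
      by (intro lin_comb_cong) (simp add: lin_comb_def inner_sum_left)
    then show ?thesis
      by (simp add: lin_comb_add lin_comb_inner[OF B inV(2)])
  qed
  have [measurable]: "(\<lambda>(t, u). lin_comb B t + lin_comb C u) \<in> borel_measurable (?LB \<Otimes>\<^sub>M ?LC)"
    unfolding sum_B by measurable
  have "(\<integral>\<^sup>+t. f (lin_comb B t) \<partial>?LB) * (\<integral>\<^sup>+u. g (lin_comb C u) \<partial>?LC)
      = (\<integral>\<^sup>+u. (\<integral>\<^sup>+t. f (lin_comb B t) \<partial>?LB) * g (lin_comb C u) \<partial>?LC)"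
    by (rule nn_integral_cmult[symmetric]) measurable
  also have "\<dots> = (\<integral>\<^sup>+u. (\<integral>\<^sup>+t. f (lin_comb B t + lin_comb C u) \<partial>?LB) * g (lin_comb C u) \<partial>?LC)"
    by (subst nn_integral_lin_comb_shift[OF B _ inV(2)]) auto
  also have "\<dots> = (\<integral>\<^sup>+u. \<integral>\<^sup>+t. f (lin_comb B t + lin_comb C u) * g (lin_comb C u) \<partial>?LB \<partial>?LC)"
  proof (intro nn_integral_cong nn_integral_multc[symmetric])
    fix u assume "u \<in> space ?LC"
    then show "(\<lambda>t. f (lin_comb B t + lin_comb C u)) \<in> borel_measurable ?LB"
      by measurable
  qed
  also have "\<dots> = (\<integral>\<^sup>+t. \<integral>\<^sup>+u. f (lin_comb B t + lin_comb C u) * g (lin_comb C u) \<partial>?LC \<partial>?LB)"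
    by (rule LBC.Fubini') measurable
  also have "\<dots> = (\<integral>\<^sup>+t. \<integral>\<^sup>+u. f (lin_comb C u) * g (lin_comb C u - lin_comb B t) \<partial>?LC \<partial>?LB)"
  proof (rule nn_integral_cong)
    fix t
    have "(\<lambda>x. f x * g (x - lin_comb B t)) \<in> borel_measurable borel"
    proof -
      have [measurable]: "(\<lambda>x. x - lin_comb B t) \<in> borel_measurable borel"
        by (intro borel_measurable_continuous_onI continuous_intros)
      show ?thesis by measurable
    qed
    from nn_integral_lin_comb_shift[OF C this inV(1)[of t]]
    show "(\<integral>\<^sup>+u. f (lin_comb B t + lin_comb C u) * g (lin_comb C u) \<partial>?LC)
        = (\<integral>\<^sup>+u. f (lin_comb C u) * g (lin_comb C u - lin_comb B t) \<partial>?LC)"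
      by (simp add: add.commute)
  qed
  also have "\<dots> = (\<integral>\<^sup>+t. \<integral>\<^sup>+u. f (lin_comb C u) * g (lin_comb B t + - lin_comb C u) \<partial>?LC \<partial>?LB)"
    using even[of "lin_comb B _ - lin_comb C _"] by simp
  also have "\<dots> = (\<integral>\<^sup>+u. \<integral>\<^sup>+t. f (lin_comb C u) * g (lin_comb B t + - lin_comb C u) \<partial>?LB \<partial>?LC)"
  proof (rule LBC.Fubini'[symmetric])
    have "lin_comb B t + - lin_comb C u = lin_comb B t + lin_comb C (\<lambda>c\<in>C. - u c)" for t u
      by (simp add: lin_comb_def sum_negf)
    then have [measurable]: "(\<lambda>(t, u). lin_comb B t + - lin_comb C u) \<in> borel_measurable (?LB \<Otimes>\<^sub>M ?LC)"
      unfolding sum_B by simp measurable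
    show "(\<lambda>(t, u). f (lin_comb C u) * g (lin_comb B t + - lin_comb C u)) \<in> borel_measurable (?LB \<Otimes>\<^sub>M ?LC)"
      by measurable
  qed
  also have "\<dots> = (\<integral>\<^sup>+u. f (lin_comb C u) * (\<integral>\<^sup>+t. g (lin_comb B t + - lin_comb C u) \<partial>?LB) \<partial>?LC)"
  proof (intro nn_integral_cong nn_integral_cmult)
    fix u
    have [measurable]: "(\<lambda>x. x + - lin_comb C u) \<in> borel_measurable borel"
      by (intro borel_measurable_continuous_onI continuous_intros)
    have "(\<lambda>t. g ((\<lambda>x. x + - lin_comb C u) (lin_comb B t))) \<in> borel_measurable ?LB"
      by measurable
    then show "(\<lambda>t. g (lin_comb B t + - lin_comb C u)) \<in> borel_measurable ?LB"
      by simp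
  qed
  also have "\<dots> = (\<integral>\<^sup>+u. f (lin_comb C u) * (\<integral>\<^sup>+t. g (lin_comb B t) \<partial>?LB) \<partial>?LC)"
    by (subst nn_integral_lin_comb_shift[OF B _ inV(4)]) auto
  also have "\<dots> = (\<integral>\<^sup>+u. f (lin_comb C u) \<partial>?LC) * (\<integral>\<^sup>+t. g (lin_comb B t) \<partial>?LB)"
    by (rule nn_integral_multc) measurable
  finally show ?thesis .
qed

section \<open>The standard Gaussian on a finite-dimensional subspace\<close>

abbreviation std_normal :: "real measure" where
  "std_normal \<equiv> density lborel (\<lambda>x. ennreal (std_normal_density x))"

definition std_gaussian :: "'a::real_inner set \<Rightarrow> 'a measure" where
  "std_gaussian B = distr (PiM B (\<lambda>_. std_normal)) borel (lin_comb B)"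

lemma prob_space_std_normal: "prob_space std_normal"
  by (rule prob_space_normal_density) simp

interpretation std_normal_prod: product_prob_space "\<lambda>_. std_normal" UNIV
  by (intro product_prob_spaceI prob_space_std_normal)

lemma measurable_PiM_std_normal [simp]:
  "measurable (PiM B (\<lambda>_. std_normal)) N = measurable (PiM B (\<lambda>_. borel)) N"
  by (intro measurable_cong_sets sets_PiM_cong refl) auto

text \<open>Both sides give a box the product of the standard normal masses of its edges.\<close>

lemma PiM_std_normal_density:
  assumes "finite B"
  shows "PiM B (\<lambda>_. std_normal)
       = density (coord_lebesgue B) (\<lambda>t. \<Prod>b\<in>B. ennreal (std_normal_density (t b)))"
proof (rule std_normal_prod.PiM_eqI[OF assms, symmetric])
  show "sets (density (coord_lebesgue B) (\<lambda>t. \<Prod>b\<in>B. ennreal (std_normal_density (t b))))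
      = sets (PiM B (\<lambda>_. std_normal))"
    by (simp, intro sets_PiM_cong) auto
  fix A :: "'a \<Rightarrow> real set"
  assume "\<And>b. b \<in> B \<Longrightarrow> A b \<in> sets std_normal"
  then have A: "A b \<in> sets borel" if "b \<in> B" for b
    using that by simp
  then have box: "PiE B A \<in> sets (coord_lebesgue B)"
    using assms by (intro sets_PiM_I_finite) auto
  have "emeasure (density (coord_lebesgue B) (\<lambda>t. \<Prod>b\<in>B. ennreal (std_normal_density (t b)))) (PiE B A)
      = (\<integral>\<^sup>+t. (\<Prod>b\<in>B. ennreal (std_normal_density (t b))) * indicator (PiE B A) t \<partial>coord_lebesgue B)"
    using box assms by (intro emeasure_density) auto
  also have "\<dots> = (\<integral>\<^sup>+t. (\<Prod>b\<in>B. ennreal (std_normal_density (t b)) * indicator (A b) (t b)) \<partial>coord_lebesgue B)"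
  proof (rule nn_integral_cong)
    fix t assume "t \<in> space (coord_lebesgue B)"
    then have "indicator (PiE B A) t = (\<Prod>b\<in>B. indicator (A b) (t b) :: ennreal)"
      using assms by (auto simp: indicator_def space_PiM PiE_iff prod_zero_iff)
    then show "(\<Prod>b\<in>B. ennreal (std_normal_density (t b))) * indicator (PiE B A) t
        = (\<Prod>b\<in>B. ennreal (std_normal_density (t b)) * indicator (A b) (t b))"
      by (simp add: prod.distrib)
  qed
  also have "\<dots> = (\<Prod>b\<in>B. \<integral>\<^sup>+x. ennreal (std_normal_density x) * indicator (A b) x \<partial>lborel)"
    using assms A by (intro lborel_prod.product_nn_integral_prod) auto
  also have "\<dots> = (\<Prod>b\<in>B. emeasure std_normal (A b))"
    using A by (intro prod.cong refl emeasure_density[symmetric]) auto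
  finally show "emeasure (density (coord_lebesgue B) (\<lambda>t. \<Prod>b\<in>B. ennreal (std_normal_density (t b)))) (PiE B A)
      = (\<Prod>b\<in>B. emeasure std_normal (A b))" .
qed

lemma sets_std_gaussian [simp, measurable_cong]: "sets (std_gaussian B) = sets borel"
  by (simp add: std_gaussian_def)

lemma space_std_gaussian [simp]: "space (std_gaussian B) = UNIV"
  by (simp add: std_gaussian_def)

lemma prob_space_std_gaussian:
  assumes "orthonormal_basis V B"
  shows "prob_space (std_gaussian B)"
proof -
  have "prob_space (PiM B (\<lambda>_. std_normal))"
    by (intro prob_space_PiM prob_space_std_normal)
  then show ?thesis
    unfolding std_gaussian_def using measurable_lin_comb[OF assms]
    by (intro prob_space.prob_space_distr) simp_all
qed

lemma emeasure_std_gaussian: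
  assumes "orthonormal_basis V B" "A \<in> sets borel"
  shows "emeasure (std_gaussian B) A
       = emeasure (PiM B (\<lambda>_. std_normal)) {t \<in> space (PiM B (\<lambda>_. std_normal)). lin_comb B t \<in> A}"
  unfolding std_gaussian_def using assms measurable_lin_comb[OF assms(1)]
  by (subst emeasure_distr) (auto simp: vimage_def Int_def conj_commute)

text \<open>On a subspace of dimension \<open>d\<close> this is the density of the standard Gaussian. Since it depends on the
  vector through its norm alone, it is the same function for all orthonormal bases.\<close>

definition gauss_density :: "nat \<Rightarrow> 'a::real_inner \<Rightarrow> real" where
  "gauss_density d x = (2 * pi) powr (- real d / 2) * exp (- (norm x)\<^sup>2 / 2)"

lemma gauss_density_nonneg [simp]: "0 \<le> gauss_density d x"
  by (simp add: gauss_density_def)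

lemma gauss_density_measurable [measurable]: "gauss_density d \<in> borel_measurable borel"
  unfolding gauss_density_def by measurable

lemma prod_std_normal_density:
  assumes "orthonormal_basis V B"
  shows "(\<Prod>b\<in>B. std_normal_density (t b)) = gauss_density (card B) (lin_comb B t)"
proof -
  have "(\<Prod>b\<in>B. std_normal_density (t b)) = (1 / sqrt (2 * pi)) ^ card B * exp (- (\<Sum>b\<in>B. (t b)\<^sup>2) / 2)"
    using orthonormalD(1)[OF assms]
    by (simp add: std_normal_density_def prod.distrib exp_sum[symmetric] sum_divide_distrib sum_negf prod_dividef power_divide)
  also have "(1 / sqrt (2 * pi)) ^ card B = (2 * pi) powr (- real (card B) / 2)"
  proof -
    have "(1 / sqrt (2 * pi)) = (2 * pi) powr (- 1 / 2)"
      using powr_half_sqrt[of "2 * pi"] by (simp add: powr_minus_divide)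
    then show ?thesis
      by (simp add: powr_realpow[symmetric] powr_powr)
  qed
  finally show ?thesis
    by (simp add: gauss_density_def norm_lin_comb[OF assms])
qed

lemma nn_integral_std_gaussian:
  assumes B: "orthonormal_basis V B" and [measurable]: "f \<in> borel_measurable borel"
  shows "(\<integral>\<^sup>+x. f x \<partial>std_gaussian B)
       = (\<integral>\<^sup>+t. ennreal (gauss_density (card B) (lin_comb B t)) * f (lin_comb B t) \<partial>coord_lebesgue B)"
proof -
  note [measurable] = measurable_lin_comb[OF B]
  have "(\<integral>\<^sup>+x. f x \<partial>std_gaussian B) = (\<integral>\<^sup>+t. f (lin_comb B t) \<partial>PiM B (\<lambda>_. std_normal))"
    unfolding std_gaussian_def by (rule nn_integral_distr) simp_all
  also have "\<dots> = (\<integral>\<^sup>+t. (\<Prod>b\<in>B. ennreal (std_normal_density (t b))) * f (lin_comb B t) \<partial>coord_lebesgue B)"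
    unfolding PiM_std_normal_density[OF orthonormalD(1)[OF B]]
    by (rule nn_integral_density) simp_all
  also have "(\<lambda>t. \<Prod>b\<in>B. ennreal (std_normal_density (t b))) = (\<lambda>t. ennreal (gauss_density (card B) (lin_comb B t)))"
    by (simp add: prod_ennreal prod_std_normal_density[OF B])
  finally show ?thesis .
qed

text \<open>Rotation invariance. The two measures have the same radial density with respect to the two Lebesgue
  measures, and these agree up to a factor by \<open>lebesgue_unique_up_to_factor\<close>. The factor is one because both Gaussians have total
  mass one: take the density itself as the even function \<open>g\<close>.\<close>

lemma std_gaussian_basis_independent:
  assumes B: "orthonormal_basis V B" and C: "orthonormal_basis V C"
  shows "std_gaussian B = std_gaussian C"
proof (rule measure_eqI)
  have card: "card C = card B"
    using dim_orthonormal_basis[OF B] dim_orthonormal_basis[OF C] by simp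
  fix A assume "A \<in> sets (std_gaussian B)"
  then have [measurable]: "A \<in> sets borel" by simp
  define w :: "'a \<Rightarrow> ennreal" where "w = (\<lambda>x. ennreal (gauss_density (card B) x))"
  have [measurable]: "w \<in> borel_measurable borel" by (simp add: w_def)
  have mass: "(\<integral>\<^sup>+t. w (lin_comb B t) \<partial>coord_lebesgue B) = 1" "(\<integral>\<^sup>+t. w (lin_comb C t) \<partial>coord_lebesgue C) = 1"
    using nn_integral_std_gaussian[OF B, of "\<lambda>_. 1"] nn_integral_std_gaussian[OF C, of "\<lambda>_. 1"]
      prob_space.emeasure_space_1[OF prob_space_std_gaussian[OF B]]
      prob_space.emeasure_space_1[OF prob_space_std_gaussian[OF C]] card
    by (simp_all add: w_def)
  have em: "emeasure (std_gaussian X) A = (\<integral>\<^sup>+t. w (lin_comb X t) * indicator A (lin_comb X t) \<partial>coord_lebesgue X)"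
    if "orthonormal_basis V X" "card X = card B" for X
    using nn_integral_std_gaussian[OF that(1), of "indicator A"] that(2) by (simp add: w_def)
  have "(\<integral>\<^sup>+t. w (lin_comb B t) * indicator A (lin_comb B t) \<partial>coord_lebesgue B)
      * (\<integral>\<^sup>+t. w (lin_comb C t) \<partial>coord_lebesgue C)
      = (\<integral>\<^sup>+t. w (lin_comb C t) * indicator A (lin_comb C t) \<partial>coord_lebesgue C)
      * (\<integral>\<^sup>+t. w (lin_comb B t) \<partial>coord_lebesgue B)"
    by (rule lebesgue_unique_up_to_factor[OF B C]) (auto simp: w_def gauss_density_def)
  then show "emeasure (std_gaussian B) A = emeasure (std_gaussian C) A"
    unfolding mass by (simp add: em B C card)
qed simp

text \<open>If membership in \<open>A\<close> depends only on the coordinates that belong to \<open>B\<close>, the remaining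
  coordinates integrate out, because the marginal of a product of probability measures is the product
  over the smaller index set.\<close>

lemma emeasure_std_gaussian_subset:
  assumes D: "orthonormal_basis W D" and B: "orthonormal_basis V B" and "B \<subseteq> D"
    and A: "A \<in> sets borel" and cyl: "\<And>t. lin_comb D t \<in> A \<longleftrightarrow> lin_comb B t \<in> A"
  shows "emeasure (std_gaussian D) A = emeasure (std_gaussian B) A"
proof -
  note [measurable] = measurable_lin_comb[OF B] A
  let ?MB = "PiM B (\<lambda>_. std_normal)" and ?MD = "PiM D (\<lambda>_. std_normal)"
  have [measurable]: "lin_comb B \<in> borel_measurable ?MB" by simp
  have "emeasure (std_gaussian B) A = emeasure ?MB {t \<in> space ?MB. lin_comb B t \<in> A}"
    by (rule emeasure_std_gaussian[OF B A])
  also have "\<dots> = emeasure (distr ?MD ?MB (\<lambda>t. restrict t B)) {t \<in> space ?MB. lin_comb B t \<in> A}"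
    by (subst std_normal_prod.distr_restrict[OF \<open>B \<subseteq> D\<close> orthonormalD(1)[OF D]]) simp
  also have "\<dots> = emeasure ?MD {t \<in> space ?MD. lin_comb B (restrict t B) \<in> A}"
  proof (subst emeasure_distr)
    show "(\<lambda>t. restrict t B) \<in> measurable ?MD ?MB"
      using \<open>B \<subseteq> D\<close> by (rule measurable_restrict_subset)
    show "{t \<in> space ?MB. lin_comb B t \<in> A} \<in> sets ?MB"
      by measurable
    have "restrict t B \<in> space ?MB" for t
      by (simp add: space_PiM)
    then have "(\<lambda>t. restrict t B) -` {t \<in> space ?MB. lin_comb B t \<in> A} \<inter> space ?MD
        = {t \<in> space ?MD. lin_comb B (restrict t B) \<in> A}"
      by blast
    then show "emeasure ?MD ((\<lambda>t. restrict t B) -` {t \<in> space ?MB. lin_comb B t \<in> A} \<inter> space ?MD)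
        = emeasure ?MD {t \<in> space ?MD. lin_comb B (restrict t B) \<in> A}" by simp
  qed
  also have "\<dots> = emeasure ?MD {t \<in> space ?MD. lin_comb D t \<in> A}"
  proof -
    have "lin_comb B (restrict t B) = lin_comb B t" for t
      by (intro lin_comb_cong) simp
    then show ?thesis by (simp add: cyl)
  qed
  also have "\<dots> = emeasure (std_gaussian D) A"
    by (rule emeasure_std_gaussian[OF D A, symmetric])
  finally show ?thesis ..
qed

text \<open>Completing the square: \<open>c * x - x\<^sup>2 / 2 = c\<^sup>2 / 2 - (x - c)\<^sup>2 / 2\<close>.\<close>

lemma nn_integral_exp_std_normal: "(\<integral>\<^sup>+x. ennreal (exp (c * x)) \<partial>std_normal) = ennreal (exp (c\<^sup>2 / 2))"
proof -
  have "(\<integral>\<^sup>+x. ennreal (exp (c * x)) \<partial>std_normal)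
      = (\<integral>\<^sup>+x. ennreal (std_normal_density x) * ennreal (exp (c * x)) \<partial>lborel)"
    by (rule nn_integral_density) auto
  also have "\<dots> = (\<integral>\<^sup>+x. ennreal (exp (c\<^sup>2 / 2)) * ennreal (normal_density c 1 x) \<partial>lborel)"
  proof (intro nn_integral_cong)
    fix x :: real
    have "exp (- x\<^sup>2 / 2) * exp (c * x) = exp (c\<^sup>2 / 2) * exp (- (x - c)\<^sup>2 / 2)"
      by (simp add: exp_add[symmetric] power2_diff field_simps)
    then show "ennreal (std_normal_density x) * ennreal (exp (c * x))
        = ennreal (exp (c\<^sup>2 / 2)) * ennreal (normal_density c 1 x)"
      by (simp add: ennreal_mult[symmetric] normal_density_def)
  qed
  also have "\<dots> = ennreal (exp (c\<^sup>2 / 2)) * (\<integral>\<^sup>+x. ennreal (normal_density c 1 x) \<partial>lborel)"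
    by (rule nn_integral_cmult) auto
  also have "(\<integral>\<^sup>+x. ennreal (normal_density c 1 x) \<partial>lborel) = 1"
    using prob_space.emeasure_space_1[OF prob_space_normal_density[of 1 c]]
    by (simp add: emeasure_density)
  finally show ?thesis by simp
qed

text \<open>The coordinates are independent standard normal variables, so the integral is exactly the exponential of
  half the squared length of the component of \<open>v\<close> in the subspace. By Bessel's inequality this is
  bounded by half the squared length of \<open>v\<close>, uniformly in the subspace.\<close>

lemma nn_integral_exp_inner_le:
  assumes B: "orthonormal_basis V B"
  shows "(\<integral>\<^sup>+x. ennreal (exp (inner x v)) \<partial>std_gaussian B) \<le> ennreal (exp ((norm v)\<^sup>2 / 2))"
proof -
  note [measurable] = measurable_lin_comb[OF B]
  note fin = orthonormalD(1)[OF B]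
  have "(\<integral>\<^sup>+x. ennreal (exp (inner x v)) \<partial>std_gaussian B)
      = (\<integral>\<^sup>+t. ennreal (exp (inner (lin_comb B t) v)) \<partial>PiM B (\<lambda>_. std_normal))"
    unfolding std_gaussian_def
    by (rule nn_integral_distr) (auto intro!: borel_measurable_continuous_onI continuous_intros measurable_compose[OF _ measurable_ennreal])
  also have "\<dots> = (\<integral>\<^sup>+t. (\<Prod>b\<in>B. ennreal (exp (inner b v * t b))) \<partial>PiM B (\<lambda>_. std_normal))"
    using fin by (intro nn_integral_cong)
      (simp add: lin_comb_def inner_sum_left exp_sum prod_ennreal mult.commute)
  also have "\<dots> = (\<Prod>b\<in>B. \<integral>\<^sup>+x. ennreal (exp (inner b v * x)) \<partial>std_normal)"
    using fin by (rule std_normal_prod.product_nn_integral_prod) auto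
  also have "\<dots> = ennreal (exp ((\<Sum>b\<in>B. (inner v b)\<^sup>2) / 2))"
    using fin by (simp add: nn_integral_exp_std_normal prod_ennreal exp_sum sum_divide_distrib inner_commute)
  also have "\<dots> \<le> ennreal (exp ((norm v)\<^sup>2 / 2))"
    using bessel_orthonormal[OF B, of v] by (intro ennreal_leI) simp
  finally show ?thesis .
qed

section \<open>The Gauss measure of a cylinder set\<close>

lemma findim_projectionsD:
  assumes "P \<in> findim_projections"
  shows "P (P x) = P x" "inner (P x) y = inner x (P y)" "norm (P x) \<le> norm x"
    "bounded_linear P" "P \<in> borel_measurable borel" "\<exists>S. finite S \<and> range P = span S"
proof -
  from assms have lin: "linear P" and idem: "P \<circ> P = P"
    and sym: "inner (P x) y = inner x (P y)" and fin: "\<exists>S. finite S \<and> range P = span S" for x y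
    by (auto simp: findim_projections_def)
  show "P (P x) = P x" for x using idem by (metis comp_apply)
  show "inner (P x) y = inner x (P y)" by (rule sym)
  show "\<exists>S. finite S \<and> range P = span S" by (rule fin)
  have le: "norm (P x) \<le> norm x" for x
  proof -
    have "norm (P x) * norm (P x) = inner x (P (P x))"
      using sym[of x "P x"] by (simp add: power2_norm_eq_inner[symmetric] power2_eq_square)
    also have "\<dots> \<le> norm x * norm (P x)"
      using norm_cauchy_schwarz[of x "P x"] \<open>\<And>x. P (P x) = P x\<close> by simp
    finally show ?thesis
      by (metis mult_le_cancel_right norm_ge_zero less_le)
  qed
  then show "norm (P x) \<le> norm x" .
  show bl: "bounded_linear P"
    using lin le by (intro bounded_linear_intro[of P 1]) (auto simp: linear_add linear_scale)
  show "P \<in> borel_measurable borel"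
    by (intro borel_measurable_continuous_onI linear_continuous_on bl)
qed

lemma projection_eq_lin_comb:
  assumes P: "P \<in> findim_projections" and B: "orthonormal_basis (range P) B"
  shows "P x = lin_comb B (\<lambda>b. inner x b)"
proof -
  have "P b = b" if "b \<in> B" for b
    using that span_base[OF that] orthonormalD(2)[OF B] findim_projectionsD(1)[OF P] by auto
  then have "inner (P x) b = inner x b" if "b \<in> B" for b
    using that by (simp add: findim_projectionsD(2)[OF P])
  then have "lin_comb B (\<lambda>b. inner (P x) b) = lin_comb B (\<lambda>b. inner x b)"
    by (rule lin_comb_cong)
  then show ?thesis
    by (simp add: lin_comb_inner[OF B])
qed

text \<open>In an orthonormal basis that extends one of its range, an orthogonal projection forgets the
  additional coordinates.\<close>

lemma projection_lin_comb_superset: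
  assumes P: "P \<in> findim_projections" and B: "orthonormal_basis (range P) B"
    and D: "orthonormal_basis W D" and "B \<subseteq> D"
  shows "P (lin_comb D t) = lin_comb B t"
  unfolding projection_eq_lin_comb[OF P B]
  using \<open>B \<subseteq> D\<close> by (intro lin_comb_cong inner_lin_comb[OF D]) auto

text \<open>The value that a representation \<open>(P, F)\<close> assigns to its cylinder set; \<^const>\<open>gauss_measure\<close> is the
  common value of all representations.\<close>

definition cylinder_integral :: "('a::real_inner \<Rightarrow> 'a) \<Rightarrow> 'a set \<Rightarrow> real" where
  "cylinder_integral P F = (2 * pi) powr (- real (dim (range P)) / 2) *
     (LINT x:F|subspace_lebesgue (range P). exp (- (norm x)\<^sup>2 / 2))"

lemma cylinder_reprD:
  assumes "cylinder_repr P F E"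
  shows "P \<in> findim_projections" "E \<in> sets borel" "P x \<in> E \<longleftrightarrow> x \<in> E"
proof -
  show P: "P \<in> findim_projections" using assms by (simp add: cylinder_repr_def)
  have E: "E = {x. P x \<in> F}" using assms by (simp add: cylinder_repr_def)
  show "P x \<in> E \<longleftrightarrow> x \<in> E"
    by (simp add: E findim_projectionsD(1)[OF P])
  obtain S where S: "S \<in> sets borel" "F = range P \<inter> S"
    using assms by (auto simp: cylinder_repr_def sets_restrict_space)
  then have "E = P -` S" using E by auto
  then show "E \<in> sets borel"
    using measurable_sets[OF findim_projectionsD(5)[OF P] S(1)] by simp
qed

text \<open>The basis is the one that the definition of \<^const>\<open>subspace_lebesgue\<close> selects. In its coordinates
  the defining integral is the mass that the Gaussian with density \<^term>\<open>gauss_density (card B)\<close>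
  gives to \<open>F\<close>, and on the range of \<open>P\<close> the sets \<open>E\<close> and \<open>F\<close> coincide.\<close>

lemma cylinder_integral_eq:
  assumes EF: "cylinder_repr P F E"
  obtains B where "orthonormal_basis (range P) B" "cylinder_integral P F = measure (std_gaussian B) E"
proof -
  note P = cylinder_reprD(1)[OF EF]
  note [measurable] = cylinder_reprD(2)[OF EF]
  define V where "V = range P"
  define B where "B = (SOME B. orthonormal_basis V B)"
  have "\<exists>B. orthonormal_basis V B"
    using findim_projectionsD(6)[OF P] orthonormal_basis_exists unfolding V_def by metis
  then have B: "orthonormal_basis V B"
    unfolding B_def by (rule someI_ex)
  note [measurable] = measurable_lin_comb[OF B]
  have F: "F \<in> sets (restrict_space borel V)" and E: "E = {x. P x \<in> F}"
    using EF by (auto simp: cylinder_repr_def V_def)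
  have inV: "lin_comb B t \<in> V" for t
    using lin_comb_in_span[of B t] orthonormalD(2)[OF B] by simp
  have Pfix: "P (lin_comb B t) = lin_comb B t" for t
    using projection_lin_comb_superset[OF P _ B, of B] B by (simp add: V_def)
  have FE: "lin_comb B t \<in> F \<longleftrightarrow> lin_comb B t \<in> E" for t
    by (simp add: E Pfix)
  have leb: "subspace_lebesgue V = distr (coord_lebesgue B) (restrict_space borel V) (lin_comb B)"
    by (simp add: subspace_lebesgue_def Let_def B_def[symmetric] lin_comb_def[abs_def])
  have meas: "lin_comb B \<in> measurable (coord_lebesgue B) (restrict_space borel V)"
    using inV by (intro measurable_restrict_space2) auto
  have ind: "(\<lambda>x. indicator F x *\<^sub>R exp (- (norm x)\<^sup>2 / 2) :: real) \<in> borel_measurable (restrict_space borel V)"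
    using F by (intro borel_measurable_scaleR borel_measurable_indicator measurable_restrict_space1) auto
  have "(LINT x:F|subspace_lebesgue V. exp (- (norm x)\<^sup>2 / 2))
      = (LINT t|coord_lebesgue B. indicator F (lin_comb B t) *\<^sub>R exp (- (norm (lin_comb B t))\<^sup>2 / 2))"
    unfolding leb set_lebesgue_integral_def by (rule integral_distr[OF meas ind])
  then have "cylinder_integral P F
      = (LINT t|coord_lebesgue B. gauss_density (card B) (lin_comb B t) * indicator E (lin_comb B t))"
    unfolding cylinder_integral_def V_def[symmetric] dim_orthonormal_basis[OF B]
    by (simp add: gauss_density_def indicator_def FE mult_ac if_distrib flip: integral_mult_right_zero cong: if_cong)
  also have "\<dots> = enn2real (\<integral>\<^sup>+t. ennreal (gauss_density (card B) (lin_comb B t) * indicator E (lin_comb B t)) \<partial>coord_lebesgue B)"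
    by (rule integral_eq_nn_integral) auto
  also have "\<dots> = enn2real (\<integral>\<^sup>+x. indicator E x \<partial>std_gaussian B)"
    by (subst nn_integral_std_gaussian[OF B])
      (auto intro!: arg_cong[of _ _ enn2real] nn_integral_cong simp: ennreal_mult ennreal_indicator)
  also have "\<dots> = measure (std_gaussian B) E"
    by (simp add: measure_def)
  finally show ?thesis using that B by (simp add: V_def)
qed

text \<open>Two representations are compared on the sum of their ranges. Extend \<open>B\<close> to an orthonormal basis of
  the sum: since \<open>P\<close> only restricts the coordinates, the mass of \<open>E\<close> does not change. The same holds for
  \<open>C\<close>, and the two bases of the sum obtained in this way define the same Gaussian by rotation
  invariance.\<close>

lemma std_gaussian_cylinder_consistent:
  assumes E: "cylinder_repr P F E" "cylinder_repr Q G E"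
    and B: "orthonormal_basis (range P) B" and C: "orthonormal_basis (range Q) C"
  shows "measure (std_gaussian B) E = measure (std_gaussian C) E"
proof -
  have ext: "\<exists>D. orthonormal_basis (span (X \<union> Y)) D \<and> measure (std_gaussian D) E = measure (std_gaussian X) E"
    if R: "cylinder_repr R K E" and X: "orthonormal_basis (range R) X" and "finite Y" for R K X Y
  proof -
    obtain D where D: "orthonormal D" "X \<subseteq> D" "span D = span (X \<union> Y)"
      using orthonormal_extend[OF orthonormalD(3)[OF X] \<open>finite Y\<close>] by blast
    have "lin_comb D t \<in> E \<longleftrightarrow> lin_comb X t \<in> E" for t
      using cylinder_reprD(3)[OF R] projection_lin_comb_superset[OF cylinder_reprD(1)[OF R] X D(1,2)]
      by metis
    then have "emeasure (std_gaussian D) E = emeasure (std_gaussian X) E"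
      by (intro emeasure_std_gaussian_subset[OF D(1) X D(2)] cylinder_reprD(2)[OF R])
    then show ?thesis using D by (auto simp: measure_def)
  qed
  obtain D where D: "orthonormal_basis (span (B \<union> C)) D" "measure (std_gaussian D) E = measure (std_gaussian B) E"
    using ext[OF E(1) B orthonormalD(1)[OF C]] by blast
  obtain D' where D': "orthonormal_basis (span (C \<union> B)) D'" "measure (std_gaussian D') E = measure (std_gaussian C) E"
    using ext[OF E(2) C orthonormalD(1)[OF B]] by blast
  have "std_gaussian D = std_gaussian D'"
    using D(1) D'(1) by (intro std_gaussian_basis_independent[of "span (B \<union> C)"]) (simp_all add: Un_commute)
  then show ?thesis using D D' by simp
qed

lemma gauss_measure_eq_std_gaussian:
  assumes P: "P \<in> findim_projections" and B: "orthonormal_basis (range P) B" and S: "S \<in> sets borel"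
  shows "gauss_measure {x. P x \<in> S} = measure (std_gaussian B) S"
proof -
  define E where "E = {x. P x \<in> S}"
  have E: "cylinder_repr P (range P \<inter> S) E"
    using P S by (auto simp: cylinder_repr_def E_def sets_restrict_space)
  have "gauss_measure E = (THE m. \<exists>P F. cylinder_repr P F E \<and> m = cylinder_integral P F)"
    by (simp add: gauss_measure_def cylinder_integral_def)
  also have "\<dots> = measure (std_gaussian B) E"
  proof (rule the_equality)
    show "\<exists>P F. cylinder_repr P F E \<and> measure (std_gaussian B) E = cylinder_integral P F"
      using E cylinder_integral_eq[OF E] std_gaussian_cylinder_consistent[OF E E B] by metis
    show "m = measure (std_gaussian B) E" if m: "\<exists>P F. cylinder_repr P F E \<and> m = cylinder_integral P F" for m
    proof -
      obtain Q G where Q: "cylinder_repr Q G E" "m = cylinder_integral Q G"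
        using m by blast
      obtain C where "orthonormal_basis (range Q) C" "cylinder_integral Q G = measure (std_gaussian C) E"
        using cylinder_integral_eq[OF Q(1)] .
      then show ?thesis
        using std_gaussian_cylinder_consistent[OF Q(1) E _ B] Q(2) by simp
    qed
  qed
  also have "\<dots> = measure (std_gaussian B) S"
  proof -
    have "lin_comb B t \<in> E \<longleftrightarrow> lin_comb B t \<in> S" for t
      using projection_lin_comb_superset[OF P B B] by (simp add: E_def)
    then show ?thesis
      by (simp add: measure_def emeasure_std_gaussian[OF B] S cylinder_reprD(2)[OF E])
  qed
  finally show ?thesis by (simp add: E_def)
qed

lemma lin_comb_projection:
  assumes B: "orthonormal B"
  shows "(\<lambda>x. lin_comb B (\<lambda>b. inner x b)) \<in> findim_projections"
proof -
  let ?P = "\<lambda>x. lin_comb B (\<lambda>b. inner x b)"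
  have "linear ?P"
    by (intro linearI) (simp_all add: inner_add_left lin_comb_add lin_comb_def scaleR_sum_right)
  moreover have "?P \<circ> ?P = ?P"
    using lin_comb_inner[OF B lin_comb_in_span] by (simp add: fun_eq_iff)
  moreover have "inner (?P x) y = inner x (?P y)" for x y
    by (simp add: lin_comb_def inner_sum_left inner_sum_right inner_commute mult_ac)
  moreover have "range ?P = span B"
    using lin_comb_inner[OF B] lin_comb_in_span[of B] by (metis (no_types, lifting) image_subset_iff rangeI subsetI subset_antisym)
  ultimately show ?thesis
    using orthonormalD(1)[OF B] unfolding findim_projections_def by blast
qed

section \<open>Minkowski's inequality for weighted finite sums\<close>

text \<open>The boundary cases \<open>x = 0\<close> and \<open>y = 0\<close> reduce to \<open>w powr p \<le> w\<close> for \<open>0 < w \<le> 1\<close>.\<close>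

lemma powr_convex_combination:
  fixes p x y u v :: real
  assumes "1 \<le> p" "0 \<le> x" "0 \<le> y" "0 < u" "0 < v" "u + v = 1"
  shows "(u * x + v * y) powr p \<le> u * x powr p + v * y powr p"
proof -
  have shrink: "(w * z) powr p \<le> w * z powr p" if "0 < w" "w \<le> 1" "0 \<le> z" for w z :: real
  proof -
    have "w powr p \<le> w powr 1"
      using that assms(1) by (intro powr_mono') auto
    then show ?thesis
      using that by (simp add: powr_mult mult_right_mono)
  qed
  consider "x = 0" | "y = 0" | "0 < x" "0 < y" using assms by linarith
  then show ?thesis
  proof cases
    case 3
    then show ?thesis
      using convex_onD[OF powr_convex[OF assms(1)], of v x y] assms by (simp add: eq_diff_eq[symmetric] add.commute)
  qed (use assms shrink[of u x] shrink[of v y] in auto)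
qed

text \<open>Dividing \<open>a\<close> and \<open>b\<close> by their norms would make \<open>a + b\<close>, divided by the sum of the norms, a
  convex combination of unit vectors, and convexity of the power function gives the claim. The
  norms are enlarged by \<open>e / 2\<close> so that one never divides by zero.\<close>

lemma weighted_minkowski:
  fixes p :: real and w a b :: "'i \<Rightarrow> real"
  assumes p: "1 \<le> p" and w: "\<And>i. i \<in> I \<Longrightarrow> 0 \<le> w i"
    and a: "\<And>i. i \<in> I \<Longrightarrow> 0 \<le> a i" and b: "\<And>i. i \<in> I \<Longrightarrow> 0 \<le> b i"
  shows "(\<Sum>i\<in>I. w i * (a i + b i) powr p) powr (1 / p)
    \<le> (\<Sum>i\<in>I. w i * a i powr p) powr (1 / p) + (\<Sum>i\<in>I. w i * b i powr p) powr (1 / p)"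
    (is "?ab \<le> ?a + ?b")
proof (rule field_le_epsilon)
  fix e :: real
  assume e: "0 < e"
  define A where "A = ?a + e / 2"
  define C where "C = ?b + e / 2"
  have pos: "0 < A" "0 < C"
    using e by (auto simp: A_def C_def intro: add_nonneg_pos)
  have unit: "(\<Sum>i\<in>I. w i * (c i / R) powr p) \<le> 1"
    if "(\<Sum>i\<in>I. w i * c i powr p) powr (1 / p) \<le> R" "0 < R" "\<And>i. i \<in> I \<Longrightarrow> 0 \<le> c i" for c R
  proof -
    have "(\<Sum>i\<in>I. w i * c i powr p) = ((\<Sum>i\<in>I. w i * c i powr p) powr (1 / p)) powr p"
      using p w by (simp add: powr_powr sum_nonneg)
    also have "\<dots> \<le> R powr p"
      using that p by (intro powr_mono2) auto
    finally show ?thesis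
      using that by (simp add: powr_divide sum_divide_distrib[symmetric])
  qed
  have "(\<Sum>i\<in>I. w i * ((a i + b i) / (A + C)) powr p)
      \<le> (\<Sum>i\<in>I. A / (A + C) * (w i * (a i / A) powr p) + C / (A + C) * (w i * (b i / C) powr p))"
  proof (rule sum_mono)
    fix i assume i: "i \<in> I"
    have "(a i + b i) / (A + C) = A / (A + C) * (a i / A) + C / (A + C) * (b i / C)"
      using pos by (simp add: add_divide_distrib)
    then have "((a i + b i) / (A + C)) powr p
        \<le> A / (A + C) * (a i / A) powr p + C / (A + C) * (b i / C) powr p"
      using powr_convex_combination[of p "a i / A" "b i / C" "A / (A + C)" "C / (A + C)"] p pos a[OF i] b[OF i]
      by (simp add: add_divide_distrib[symmetric])
    from mult_left_mono[OF this w[OF i]]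
    show "w i * ((a i + b i) / (A + C)) powr p
        \<le> A / (A + C) * (w i * (a i / A) powr p) + C / (A + C) * (w i * (b i / C) powr p)"
      by (simp add: algebra_simps)
  qed
  also have "\<dots> = A / (A + C) * (\<Sum>i\<in>I. w i * (a i / A) powr p) + C / (A + C) * (\<Sum>i\<in>I. w i * (b i / C) powr p)"
    by (simp add: sum.distrib sum_distrib_left)
  also have "\<dots> \<le> A / (A + C) * 1 + C / (A + C) * 1"
    using pos e a b by (intro add_mono mult_left_mono unit) (auto simp: A_def C_def)
  also have "\<dots> = 1"
    using pos by (simp add: add_divide_distrib[symmetric])
  finally have "(\<Sum>i\<in>I. w i * (a i + b i) powr p) \<le> (A + C) powr p"
    using pos a b by (simp add: powr_divide sum_divide_distrib[symmetric])
  then have "?ab \<le> ((A + C) powr p) powr (1 / p)"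
    using p w by (intro powr_mono2) (auto intro!: sum_nonneg)
  also have "\<dots> = A + C"
    using p pos by (simp add: powr_powr)
  finally show "?ab \<le> ?a + ?b + e"
    by (simp add: A_def C_def)
qed

section \<open>The Fourier-Besov seminorm\<close>

definition block_sum :: "real \<Rightarrow> real \<Rightarrow> nat \<Rightarrow> mean_zero_L2 \<Rightarrow> real" where
  "block_sum s p j f =
     (\<Sum>n\<in>dyadic_block j. japanese_bracket n powr (s * p) * cmod (fourier f n) powr p)"

lemma fourier_besov_norm_block_sum:
  "fourier_besov_norm s p f = (SUP j. ennreal (block_sum s p j f powr (1 / p)))"
  by (simp add: fourier_besov_norm_def block_sum_def)

lemma block_sum_nonneg [simp]: "0 \<le> block_sum s p j f"
  by (simp add: block_sum_def sum_nonneg)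

lemma norm_fourier_le: "cmod (fourier f n) \<le> norm f"
proof -
  have pos: "cmod (fourier f (int (Suc k))) \<le> norm f" for k
  proof -
    have "(cmod (fourier f (int (Suc k))))\<^sup>2 \<le> (\<Sum>n. (cmod (fourier f (int (Suc n))))\<^sup>2)"
      using sum_le_suminf[OF summable_fourier_sq[of f], of "{k}"] by simp
    then show ?thesis
      unfolding norm_mean_zero_L2_def by (simp add: real_le_rsqrt)
  qed
  have pos': "cmod (fourier f m) \<le> norm f" if "0 < m" for m
    using that pos[of "nat m - 1"] by simp
  show ?thesis
    using pos'[of n] pos'[of "- n"] fourier_minus_index[of f n] fourier_zero_index[of f]
    by (cases n "0 :: int" rule: linorder_cases) auto
qed

lemma bounded_linear_fourier: "bounded_linear (\<lambda>f. fourier f n)"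
  by (rule bounded_linear_intro[of _ 1])
    (simp_all add: fourier_add fourier_scaleR scaleR_conv_of_real norm_fourier_le)

lemma measurable_fourier [measurable]: "(\<lambda>f. fourier f n) \<in> borel_measurable borel"
  by (intro borel_measurable_continuous_onI linear_continuous_on bounded_linear_fourier)

lemma measurable_block_sum [measurable]: "block_sum s p j \<in> borel_measurable borel"
  unfolding block_sum_def by measurable

lemma measurable_fourier_besov_norm [measurable]: "fourier_besov_norm s p \<in> borel_measurable borel"
  unfolding fourier_besov_norm_block_sum[abs_def] by measurable

lemma dyadic_block_eq: "dyadic_block j = {2 ^ j..<2 ^ (j + 1)} \<union> uminus ` {2 ^ j..<2 ^ (j + 1)}"
  unfolding dyadic_block_def image_uminus_atLeastLessThan
proof -
  have "(0 :: int) < 2 ^ j" by simp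
  then show "{n :: int. 2 ^ j \<le> \<bar>n\<bar> \<and> \<bar>n\<bar> < 2 ^ (j + 1)} = {2 ^ j..<2 ^ (j + 1)} \<union> {- (2 ^ (j + 1))<..- (2 ^ j)}"
    by (auto simp: abs_if)
qed

lemma finite_dyadic_block [simp]: "finite (dyadic_block j)"
  by (simp add: dyadic_block_eq)

lemma card_dyadic_block_le: "card (dyadic_block j) \<le> 2 * 2 ^ j"
proof -
  have "card (dyadic_block j) \<le> card {2 ^ j..<2 ^ (j + 1) :: int} + card (uminus ` {2 ^ j..<2 ^ (j + 1) :: int})"
    unfolding dyadic_block_eq by (rule card_Un_le)
  also have "\<dots> \<le> 2 * card {2 ^ j..<2 ^ (j + 1) :: int}"
    using card_image_le[of "{2 ^ j..<2 ^ (j + 1) :: int}" uminus] by simp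
  also have "card {2 ^ j..<2 ^ (j + 1) :: int} = 2 ^ j"
    by (simp add: nat_power_eq)
  finally show ?thesis .
qed

text \<open>There are \<open>2 * 2 ^ j\<close> frequencies in the block, each with bracket at least \<open>2 ^ j\<close>. For \<open>q < - 1\<close>
  the bound decays geometrically in \<open>j\<close>; this is where the condition \<open>s * p < - 1\<close> enters.\<close>

lemma sum_bracket_dyadic_block_le:
  assumes "q < 0"
  shows "(\<Sum>n\<in>dyadic_block j. japanese_bracket n powr q) \<le> 2 * (2 powr (1 + q)) ^ j"
proof -
  have "(\<Sum>n\<in>dyadic_block j. japanese_bracket n powr q) \<le> (\<Sum>n\<in>dyadic_block j. (2 ^ j) powr q)"
  proof (rule sum_mono)
    fix n assume "n \<in> dyadic_block j"
    then have "(2 :: int) ^ j \<le> \<bar>n\<bar>"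
      by (simp add: dyadic_block_def)
    then have "real_of_int (2 ^ j) \<le> real_of_int \<bar>n\<bar>"
      by (simp only: of_int_le_iff)
    then have "2 ^ j \<le> japanese_bracket n"
      by (simp add: japanese_bracket_def)
    then show "japanese_bracket n powr q \<le> (2 ^ j) powr q"
      using assms by (intro powr_mono2') auto
  qed
  also have "\<dots> = real (card (dyadic_block j)) * (2 ^ j) powr q"
    by simp
  also have "\<dots> \<le> real (2 * 2 ^ j) * (2 ^ j) powr q"
    using card_dyadic_block_le[of j] by (intro mult_right_mono) (auto simp del: of_nat_mult of_nat_power)
  also have "\<dots> = 2 * (2 powr (1 + q)) ^ j"
    by (simp add: powr_add power_mult_distrib powr_power powr_realpow[symmetric] powr_powr mult.commute)
  finally show ?thesis .
qed

text \<open>Finiteness holds because each Fourier coefficient is bounded by the Hilbert norm and the weights of a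
  block have bounded sum; the triangle inequality is Minkowski's inequality in each block.\<close>

lemma seminorm_fourier_besov:
  assumes p: "1 \<le> p" and sp: "s * p < - 1"
  shows "seminorm (fourier_besov_norm s p)"
  unfolding seminorm_def
proof (intro conjI allI)
  fix f g :: mean_zero_L2 and c :: real
  have "block_sum s p j f \<le> 2 * norm f powr p" for j
  proof -
    have "block_sum s p j f \<le> (\<Sum>n\<in>dyadic_block j. japanese_bracket n powr (s * p)) * norm f powr p"
      unfolding block_sum_def sum_distrib_right
      using p by (intro sum_mono mult_left_mono powr_mono2 norm_fourier_le) auto
    also have "\<dots> \<le> 2 * (2 powr (1 + s * p)) ^ j * norm f powr p"
      using sp by (intro mult_right_mono sum_bracket_dyadic_block_le) auto
    also have "\<dots> \<le> 2 * 1 * norm f powr p"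
      using sp powr_mono[of "1 + s * p" 0 2] by (intro mult_right_mono mult_left_mono power_le_one) auto
    finally show ?thesis by simp
  qed
  then have "fourier_besov_norm s p f \<le> ennreal ((2 * norm f powr p) powr (1 / p))"
    unfolding fourier_besov_norm_block_sum
    using p by (intro SUP_least ennreal_leI powr_mono2) auto
  then show "fourier_besov_norm s p f < \<infinity>"
    by (rule le_less_trans) simp
  have "block_sum s p j (f + g) powr (1 / p) \<le> block_sum s p j f powr (1 / p) + block_sum s p j g powr (1 / p)" for j
  proof -
    have "block_sum s p j (f + g) powr (1 / p) \<le> (\<Sum>n\<in>dyadic_block j. japanese_bracket n powr (s * p) *
        (cmod (fourier f n) + cmod (fourier g n)) powr p) powr (1 / p)"
      unfolding block_sum_def fourier_add
      using p by (intro powr_mono2 sum_mono mult_left_mono norm_triangle_ineq) (auto intro!: sum_nonneg)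
    also have "\<dots> \<le> block_sum s p j f powr (1 / p) + block_sum s p j g powr (1 / p)"
      unfolding block_sum_def by (intro weighted_minkowski p) auto
    finally show ?thesis .
  qed
  then show "fourier_besov_norm s p (f + g) \<le> fourier_besov_norm s p f + fourier_besov_norm s p g"
    unfolding fourier_besov_norm_block_sum
  proof (intro SUP_least)
    fix j
    have "ennreal (block_sum s p j (f + g) powr (1 / p))
        \<le> ennreal (block_sum s p j f powr (1 / p) + block_sum s p j g powr (1 / p))"
      by (intro ennreal_leI) fact
    also have "\<dots> = ennreal (block_sum s p j f powr (1 / p)) + ennreal (block_sum s p j g powr (1 / p))"
      by (rule ennreal_plus) simp_all
    also have "\<dots> \<le> (SUP j. ennreal (block_sum s p j f powr (1 / p))) + (SUP j. ennreal (block_sum s p j g powr (1 / p)))"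
      by (intro add_mono SUP_upper) auto
    finally show "ennreal (block_sum s p j (f + g) powr (1 / p))
        \<le> (SUP j. ennreal (block_sum s p j f powr (1 / p))) + (SUP j. ennreal (block_sum s p j g powr (1 / p)))" .
  qed
  have "block_sum s p j (c *\<^sub>R f) powr (1 / p) = \<bar>c\<bar> * block_sum s p j f powr (1 / p)" for j
  proof -
    have "block_sum s p j (c *\<^sub>R f) = \<bar>c\<bar> powr p * block_sum s p j f"
      by (simp add: block_sum_def fourier_scaleR norm_mult powr_mult sum_distrib_left mult_ac)
    then show ?thesis
      using p by (simp add: powr_mult powr_powr)
  qed
  then show "fourier_besov_norm s p (c *\<^sub>R f) = ennreal \<bar>c\<bar> * fourier_besov_norm s p f"
    unfolding fourier_besov_norm_block_sum by (simp add: ennreal_mult SUP_mult_left_ennreal)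
qed

section \<open>Fourier modes as vectors\<close>

text \<open>The vector is the class of the function \<open>2 * Re (z * exp (\<i> * n * x))\<close>.\<close>

lemma fourier_mode_exists:
  fixes z :: complex
  assumes "0 < n"
  shows "\<exists>v. \<forall>m. fourier v m = (if m = n then z else if m = - n then cnj z else 0)"
proof -
  define f where "f = (\<lambda>x. 2 * Re (z * chr n x))"
  have f_chr: "complex_of_real (f x) = z * chr n x + cnj z * chr (- n) x" for x
  proof -
    have "complex_of_real (f x) = z * chr n x + cnj (z * chr n x)"
      unfolding f_def complex_add_cnj by simp
    then show ?thesis by (simp add: exp_cnj)
  qed
  have int: "(LINT x|torus. complex_of_real (f x) * chr (- m) x)
      = z * (if n = m then 2 * pi else 0) + cnj z * (if - n = m then 2 * pi else 0)" for m
  proof -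
    have "complex_of_real (f x) * chr (- m) x = z * chr (n - m) x + cnj z * chr (- n - m) x" for x
      unfolding f_chr using chr_mult[of n x "- m"] chr_mult[of "- n" x "- m"]
      by (simp only: ring_distribs mult.assoc) simp
    then have "(LINT x|torus. complex_of_real (f x) * chr (- m) x)
        = z * (LINT x|torus. chr (n - m) x) + cnj z * (LINT x|torus. chr (- n - m) x)"
      using integrable_chr[of "n - m"] integrable_chr[of "- n - m"]
      by (simp only: Bochner_Integration.integral_add integrable_mult_right integral_mult_right_zero)
    then show ?thesis
      by (simp only: integral_chr right_minus_eq)
  qed
  have f_bd: "\<bar>f x\<bar> \<le> 2 * cmod z" for x
    using abs_Re_le_cmod[of "z * chr n x"] by (simp add: f_def norm_mult abs_mult)
  have [measurable]: "f \<in> borel_measurable torus"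
    unfolding f_def by (intro borel_imp_torus borel_measurable_continuous_onI continuous_intros)
  have "integrable torus (\<lambda>x. (f x)\<^sup>2)"
  proof (rule torus.integrable_const_bound)
    show "AE x in torus. norm ((f x)\<^sup>2) \<le> (2 * cmod z)\<^sup>2"
      using power_mono[OF f_bd, of _ 2] by auto
  qed measurable
  moreover have "(LINT x|torus. f x) = 0"
    using int[of 0] assms integral_complex_of_real[of torus f] by simp
  ultimately have "f \<in> L2_mean_zero"
    by (simp add: L2_mean_zero_def)
  moreover have "fourier_coeff f m = (if m = n then z else if m = - n then cnj z else 0)" for m
    unfolding fourier_coeff_chr int using assms by auto
  ultimately show ?thesis
    by (intro exI[of _ "abs_mean_zero_L2 f"]) (simp add: fourier.abs_eq eq_onp_def)
qed

text \<open>The real function with coefficient \<open>z\<close> at the frequency \<open>n > 0\<close>. Pairing with it extracts the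
  real part of the \<open>n\<close>-th coefficient in the direction \<open>z\<close>, so \<open>z = 1\<close> and \<open>z = \<i>\<close> together detect
  that coefficient.\<close>

definition fourier_mode :: "int \<Rightarrow> complex \<Rightarrow> mean_zero_L2" where
  "fourier_mode n z =
     (SOME v. \<forall>m. fourier v m = (if m = n then z else if m = - n then cnj z else 0))"

lemma fourier_fourier_mode:
  "0 < n \<Longrightarrow> fourier (fourier_mode n z) m = (if m = n then z else if m = - n then cnj z else 0)"
  unfolding fourier_mode_def using someI_ex[OF fourier_mode_exists[of n z]] by blast

lemma inner_fourier_mode:
  assumes "0 < n"
  shows "inner f (fourier_mode n z) = Re (fourier f n * cnj z)"
proof -
  have "(\<lambda>k. Re (fourier f (int (Suc k)) * cnj (fourier (fourier_mode n z) (int (Suc k)))))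
      = (\<lambda>k. if k = nat (n - 1) then Re (fourier f n * cnj z) else 0)"
    using assms by (auto simp: fourier_fourier_mode fun_eq_iff)
  then show ?thesis
    unfolding inner_mean_zero_L2_def by (simp only: sums_unique[OF sums_single, symmetric])
qed

lemma norm_fourier_mode:
  assumes "0 < n"
  shows "(norm (fourier_mode n z))\<^sup>2 = (cmod z)\<^sup>2"
  unfolding power2_norm_eq_inner[of "fourier_mode n z"] inner_fourier_mode[OF assms] fourier_fourier_mode[OF assms]
  by (simp add: complex_mult_cnj cmod_power2)

section \<open>Gaussian tail of the dyadic blocks\<close>

text \<open>This is \<open>y \<le> exp y\<close> at \<open>y = x / p\<close>, raised to the power \<open>p\<close>.\<close>

lemma powr_le_exp:
  fixes p x :: real
  assumes "0 < p" "0 \<le> x"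
  shows "x powr p \<le> p powr p * exp x"
proof -
  have "x / p \<le> exp (x / p)"
    using exp_ge_add_one_self[of "x / p"] by linarith
  then have "x \<le> p * exp (x / p)"
    using assms by (simp add: field_simps)
  then have "x powr p \<le> (p * exp (x / p)) powr p"
    using assms by (intro powr_mono2) auto
  then show ?thesis
    using assms by (simp add: powr_mult exp_powr_real)
qed

text \<open>With the signs of \<open>z\<close> chosen to match those of \<open>a\<close>, the exponent is \<open>\<bar>Re a\<bar> + \<bar>Im a\<bar>\<close>. The modulus is
  thereby traded for linear functionals, whose exponential moments are known.\<close>

lemma exp_cmod_le:
  "exp (cmod a) \<le> (\<Sum>z\<in>{Complex 1 1, Complex 1 (- 1), Complex (- 1) 1, Complex (- 1) (- 1)}. exp (Re (a * cnj z)))"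
proof -
  have "exp (cmod a) \<le> exp (\<bar>Re a\<bar> + \<bar>Im a\<bar>)"
    using cmod_le[of a] by simp
  also have "\<dots> \<le> (\<Sum>z\<in>{Complex 1 1, Complex 1 (- 1), Complex (- 1) 1, Complex (- 1) (- 1)}. exp (Re (a * cnj z)))"
  proof -
    have pos: "0 < exp (Re a + Im a)" "0 < exp (Re a - Im a)" "0 < exp (- Re a + Im a)" "0 < exp (- Re a - Im a)"
      by simp_all
    show ?thesis
      using pos by (cases "0 \<le> Re a"; cases "0 \<le> Im a") (simp_all add: abs_if add_pos_pos less_imp_le)
  qed
  finally show ?thesis .
qed

text \<open>The four directions \<open>z\<close> have squared modulus \<open>2\<close>, so each exponential moment is at most
  \<open>exp 1\<close>. What matters is that the bound depends neither on \<open>n\<close> nor on the subspace.\<close>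

lemma fourier_moment_le:
  assumes B: "orthonormal_basis V B" and p: "0 < p" and n: "n \<noteq> 0"
  shows "(\<integral>\<^sup>+f. ennreal (cmod (fourier f n) powr p) \<partial>std_gaussian B) \<le> ennreal (4 * p powr p * exp 1)"
proof -
  define Z where "Z = {Complex 1 1, Complex 1 (- 1), Complex (- 1) 1, Complex (- 1) (- 1)}"
  define m where "m = \<bar>n\<bar>"
  have m: "0 < m" using n by (simp add: m_def)
  have abs: "cmod (fourier f n) = cmod (fourier f m)" for f
    using fourier_minus_index[of f n] by (simp add: m_def abs_if)
  have Z: "finite Z" "card Z = 4" "\<And>z. z \<in> Z \<Longrightarrow> (cmod z)\<^sup>2 = 2"
    by (auto simp: Z_def cmod_power2)
  have inner_meas [measurable]: "(\<lambda>f. inner f v) \<in> borel_measurable borel" for v :: mean_zero_L2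
    by (intro borel_measurable_continuous_onI continuous_intros)
  have "(\<integral>\<^sup>+f. ennreal (cmod (fourier f n) powr p) \<partial>std_gaussian B)
      \<le> (\<integral>\<^sup>+f. ennreal (p powr p) * (\<Sum>z\<in>Z. ennreal (exp (inner f (fourier_mode m z)))) \<partial>std_gaussian B)"
  proof (rule nn_integral_mono)
    fix f
    have "cmod (fourier f n) powr p \<le> p powr p * (\<Sum>z\<in>Z. exp (inner f (fourier_mode m z)))"
      unfolding abs inner_fourier_mode[OF m] Z_def
      by (intro order_trans[OF powr_le_exp] mult_left_mono exp_cmod_le) (use p in auto)
    then show "ennreal (cmod (fourier f n) powr p)
        \<le> ennreal (p powr p) * (\<Sum>z\<in>Z. ennreal (exp (inner f (fourier_mode m z))))"
      by (simp add: sum_ennreal ennreal_mult[symmetric] sum_nonneg ennreal_leI)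
  qed
  also have "\<dots> = ennreal (p powr p) * (\<Sum>z\<in>Z. \<integral>\<^sup>+f. ennreal (exp (inner f (fourier_mode m z))) \<partial>std_gaussian B)"
    by (simp add: nn_integral_cmult nn_integral_sum del: sum_ennreal)
  also have "\<dots> \<le> ennreal (p powr p) * (\<Sum>z\<in>Z. ennreal (exp 1))"
  proof (intro mult_left_mono sum_mono)
    fix z assume "z \<in> Z"
    then have "(norm (fourier_mode m z))\<^sup>2 / 2 = 1"
      using norm_fourier_mode[OF m] Z(3) by simp
    then show "(\<integral>\<^sup>+f. ennreal (exp (inner f (fourier_mode m z))) \<partial>std_gaussian B) \<le> ennreal (exp 1)"
      using nn_integral_exp_inner_le[OF B, of "fourier_mode m z"] by simp
  qed simp
  also have "\<dots> = ennreal (4 * p powr p * exp 1)"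
    by (simp add: Z(2) ennreal_mult mult_ac)
  finally show ?thesis .
qed

lemma block_sum_expectation_le:
  assumes B: "orthonormal_basis V B" and p: "0 < p" and sp: "s * p < 0"
  shows "(\<integral>\<^sup>+f. ennreal (block_sum s p j f) \<partial>std_gaussian B)
    \<le> ennreal (8 * p powr p * exp 1 * (2 powr (1 + s * p)) ^ j)"
proof -
  define K where "K = 4 * p powr p * exp 1"
  have K: "0 \<le> K" by (simp add: K_def)
  have nz: "n \<noteq> 0" if "n \<in> dyadic_block j" for n
    using that by (auto simp: dyadic_block_def)
  have "(\<integral>\<^sup>+f. ennreal (block_sum s p j f) \<partial>std_gaussian B)
      = (\<integral>\<^sup>+f. (\<Sum>n\<in>dyadic_block j. ennreal (japanese_bracket n powr (s * p)) * ennreal (cmod (fourier f n) powr p)) \<partial>std_gaussian B)"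
    by (simp add: block_sum_def sum_ennreal ennreal_mult[symmetric])
  also have "\<dots> = (\<Sum>n\<in>dyadic_block j. ennreal (japanese_bracket n powr (s * p)) * (\<integral>\<^sup>+f. ennreal (cmod (fourier f n) powr p) \<partial>std_gaussian B))"
    by (simp add: nn_integral_cmult nn_integral_sum)
  also have "\<dots> \<le> (\<Sum>n\<in>dyadic_block j. ennreal (japanese_bracket n powr (s * p)) * ennreal K)"
    unfolding K_def using nz by (intro sum_mono mult_left_mono fourier_moment_le[OF B p]) auto
  also have "\<dots> = ennreal ((\<Sum>n\<in>dyadic_block j. japanese_bracket n powr (s * p)) * K)"
    using K by (simp add: sum_ennreal ennreal_mult[symmetric] sum_distrib_right)
  also have "\<dots> \<le> ennreal (2 * (2 powr (1 + s * p)) ^ j * K)"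
    using K sp by (intro ennreal_leI mult_right_mono sum_bracket_dyadic_block_le) auto
  finally show ?thesis by (simp add: K_def mult_ac)
qed

text \<open>The Gaussian is a measure on the whole space; it is carried by its subspace.\<close>

lemma AE_std_gaussian:
  assumes B: "orthonormal_basis V B" and "{x. Q x} \<in> sets borel" and "\<And>x. x \<in> V \<Longrightarrow> Q x"
  shows "AE x in std_gaussian B. Q x"
proof -
  have "lin_comb B t \<in> V" for t
    using lin_comb_in_span[of B t] orthonormalD(2)[OF B] by simp
  then show ?thesis
    unfolding std_gaussian_def using assms measurable_lin_comb[OF B]
    by (subst AE_distr_iff) simp_all
qed

text \<open>If the norm exceeds \<open>\<epsilon>\<close>, some block sum exceeds \<open>\<epsilon> powr p\<close>, and on \<open>V\<close> its index is at least \<open>J\<close>.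
  So the sum of all block sums from \<open>J\<close> on exceeds \<open>\<epsilon> powr p\<close>, and Markov's inequality together
  with the geometric bound on the expected block sums gives the estimate.\<close>

lemma fourier_besov_tail_le:
  assumes B: "orthonormal_basis V B" and p: "0 < p" and sp: "s * p < - 1" and \<epsilon>: "0 < \<epsilon>"
    and low: "\<And>f j. f \<in> V \<Longrightarrow> j < J \<Longrightarrow> block_sum s p j f = 0"
  shows "emeasure (std_gaussian B) {f. ennreal \<epsilon> < fourier_besov_norm s p f}
    \<le> ennreal (8 * p powr p * exp 1 / (\<epsilon> powr p * (1 - 2 powr (1 + s * p))) * (2 powr (1 + s * p)) ^ J)"
proof -
  define r where "r = 2 powr (1 + s * p)"
  define K where "K = 8 * p powr p * exp 1"
  have r: "0 < r" "r < 1"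
    using sp powr_less_mono[of "1 + s * p" 0 2] by (auto simp: r_def)
  have K: "0 \<le> K" by (simp add: K_def)
  let ?A = "{f. ennreal \<epsilon> < fourier_besov_norm s p f}"
  have A [measurable]: "?A \<in> sets borel" by measurable
  let ?T = "\<lambda>f. ennreal (1 / \<epsilon> powr p) * (\<Sum>i. ennreal (block_sum s p (i + J) f))"
  have AE_low: "AE f in std_gaussian B. \<forall>j\<in>{..<J}. block_sum s p j f = 0"
  proof (rule AE_std_gaussian[OF B])
    have "{f. \<forall>j\<in>{..<J}. block_sum s p j f = 0} = UNIV \<inter> (\<Inter>j\<in>{..<J}. block_sum s p j -` {0})"
      by auto
    also have "\<dots> \<in> sets borel"
      by (cases "J = 0") (auto intro!: sets.Int sets.finite_INT measurable_sets_borel[OF measurable_block_sum])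
    finally show "{f. \<forall>j\<in>{..<J}. block_sum s p j f = 0} \<in> sets borel" .
  qed (use low in auto)
  have "emeasure (std_gaussian B) ?A = (\<integral>\<^sup>+f. indicator ?A f \<partial>std_gaussian B)"
    by simp
  also have "\<dots> \<le> (\<integral>\<^sup>+f. ?T f \<partial>std_gaussian B)"
  proof (rule nn_integral_mono_AE, rule AE_mp[OF AE_low AE_I2], rule impI)
    fix f assume f: "\<forall>j\<in>{..<J}. block_sum s p j f = 0"
    show "indicator ?A f \<le> ?T f"
    proof (cases "f \<in> ?A")
      case True
      then obtain j where j: "ennreal \<epsilon> < ennreal (block_sum s p j f powr (1 / p))"
        by (auto simp: fourier_besov_norm_block_sum less_SUP_iff)
      then have gt: "\<epsilon> < block_sum s p j f powr (1 / p)"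
        using \<epsilon> by (simp add: ennreal_less_iff)
      have "J \<le> j"
        using f gt \<epsilon> by (cases "j < J") auto
      have "\<epsilon> powr p \<le> (block_sum s p j f powr (1 / p)) powr p"
        using gt \<epsilon> p by (intro powr_mono2) auto
      then have "\<epsilon> powr p \<le> block_sum s p j f"
        using p by (simp add: powr_powr)
      then have "1 \<le> ennreal (1 / \<epsilon> powr p) * ennreal (block_sum s p j f)"
        using \<epsilon> by (simp add: ennreal_mult[symmetric] field_simps)
      also have "\<dots> \<le> ?T f"
      proof (rule mult_left_mono)
        have "sum (\<lambda>i. ennreal (block_sum s p (i + J) f)) {j - J} \<le> (\<Sum>i. ennreal (block_sum s p (i + J) f))"
          by (rule sum_le_suminf) auto
        then show "ennreal (block_sum s p j f) \<le> (\<Sum>i. ennreal (block_sum s p (i + J) f))"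
          using \<open>J \<le> j\<close> by simp
      qed simp
      finally show ?thesis using True by simp
    qed simp
  qed
  also have "\<dots> = ennreal (1 / \<epsilon> powr p) * (\<Sum>i. \<integral>\<^sup>+f. ennreal (block_sum s p (i + J) f) \<partial>std_gaussian B)"
    by (simp add: nn_integral_cmult nn_integral_suminf)
  also have "\<dots> \<le> ennreal (1 / \<epsilon> powr p) * (\<Sum>i. ennreal (K * r ^ (i + J)))"
    using sp unfolding K_def r_def
    by (intro mult_left_mono suminf_le block_sum_expectation_le[OF B p]) auto
  also have "(\<Sum>i. ennreal (K * r ^ (i + J))) = ennreal (K * r ^ J / (1 - r))"
  proof (rule suminf_ennreal_eq)
    show "0 \<le> K * r ^ (i + J)" for i
      using K r by simp
    have "(\<lambda>i. K * r ^ J * r ^ i) sums (K * r ^ J * (1 / (1 - r)))"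
      using r by (intro sums_mult geometric_sums) simp
    then show "(\<lambda>i. K * r ^ (i + J)) sums (K * r ^ J / (1 - r))"
      by (simp add: power_add mult_ac)
  qed
  also have "ennreal (1 / \<epsilon> powr p) * ennreal (K * r ^ J / (1 - r)) = ennreal (K / (\<epsilon> powr p * (1 - r)) * r ^ J)"
    using K r by (simp add: ennreal_mult[symmetric])
  finally show ?thesis
    by (simp add: K_def r_def)
qed

lemma projection_fixing_exists:
  fixes S :: "'a::real_inner set"
  assumes "finite S"
  shows "\<exists>P\<in>findim_projections. \<forall>v\<in>S. P v = v"
proof -
  obtain B where B: "orthonormal_basis (span S) B"
    using orthonormal_basis_exists[OF assms] .
  show ?thesis
    using lin_comb_inner[OF B span_base]
    by (intro bexI[of _ "\<lambda>x. lin_comb B (\<lambda>b. inner x b)"] ballI lin_comb_projection orthonormalD(3)[OF B])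
qed

lemma block_sum_eq_0:
  assumes "\<And>n z. 0 < n \<Longrightarrow> n < 2 ^ (j + 1) \<Longrightarrow> z \<in> {1, \<i>} \<Longrightarrow> inner f (fourier_mode n z) = 0"
  shows "block_sum s p j f = 0"
proof -
  have pos: "fourier f n = 0" if "0 < n" "n < 2 ^ (j + 1)" for n
    using that assms[of n 1] assms[of n \<i>] by (simp add: inner_fourier_mode complex_eq_iff)
  have "fourier f n = 0" if "n \<in> dyadic_block j" for n
  proof -
    have "n \<noteq> 0" "\<bar>n\<bar> < 2 ^ (j + 1)"
      using that by (auto simp: dyadic_block_def)
    then show ?thesis
      using pos[of n] pos[of "- n"] fourier_minus_index[of f n] by (cases "0 < n") auto
  qed
  then show ?thesis
    by (simp add: block_sum_def)
qed

theorem proposition3p4: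
  fixes p s :: real
  assumes "1 \<le> p" and "s * p < - 1"
  shows "measurable_seminorm (fourier_besov_norm s p)"
  unfolding measurable_seminorm_def
proof (intro conjI allI impI seminorm_fourier_besov assms)
  fix \<epsilon> :: real
  assume \<epsilon>: "0 < \<epsilon>"
  define r where "r = 2 powr (1 + s * p)"
  \<comment> \<open>The constant of \<open>fourier_besov_tail_le\<close>, so that the tail is at most \<open>c * r ^ J\<close>.\<close>
  define c where "c = 8 * p powr p * exp 1 / (\<epsilon> powr p * (1 - r))"
  have r: "0 < r" "r < 1"
    using assms(2) powr_less_mono[of "1 + s * p" 0 2] by (auto simp: r_def)
  have c: "0 < c"
    using assms(1) \<epsilon> r by (simp add: c_def)
  obtain J where J: "r ^ J < \<epsilon> / c"
    using real_arch_pow_inv[of "\<epsilon> / c" r] \<epsilon> c r by auto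
  \<comment> \<open>\<open>P\<^sub>0\<close> fixes all modes of frequency below \<open>2 ^ J\<close>, so a projection orthogonal to it
    has no block sums with index below \<open>J\<close>.\<close>
  define S where "S = (\<lambda>(n, z). fourier_mode n z) ` ({0<..<2 ^ J} \<times> {1, \<i>})"
  have "finite S" by (simp add: S_def)
  then obtain P\<^sub>0 where P0: "P\<^sub>0 \<in> findim_projections" "\<And>v. v \<in> S \<Longrightarrow> P\<^sub>0 v = v"
    using projection_fixing_exists by metis
  show "\<exists>P\<^sub>0\<in>findim_projections. \<forall>P\<in>findim_projections. (\<forall>x y. inner (P x) (P\<^sub>0 y) = 0) \<longrightarrow>
      gauss_measure {x. ennreal \<epsilon> < fourier_besov_norm s p (P x)} < \<epsilon>"
  proof (intro bexI[OF _ P0(1)] ballI impI)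
    fix P assume P: "P \<in> findim_projections" and orth: "\<forall>x y. inner (P x) (P\<^sub>0 y) = 0"
    obtain B where B: "orthonormal_basis (range P) B"
      using findim_projectionsD(6)[OF P] orthonormal_basis_exists by metis
    let ?A = "{f. ennreal \<epsilon> < fourier_besov_norm s p f}"
    have low: "block_sum s p j f = 0" if "f \<in> range P" "j < J" for f j
    proof (rule block_sum_eq_0)
      fix n :: int and z assume n: "0 < n" "n < 2 ^ (j + 1)" "z \<in> {1, \<i>}"
      have "(2 :: int) ^ (j + 1) \<le> 2 ^ J"
        using \<open>j < J\<close> by (intro power_increasing) auto
      then have "fourier_mode n z \<in> S"
        using n unfolding S_def by (intro image_eqI[of _ _ "(n, z)"]) auto
      then show "inner f (fourier_mode n z) = 0"
        using orth P0(2) \<open>f \<in> range P\<close> by (metis imageE)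
    qed
    have "emeasure (std_gaussian B) ?A \<le> ennreal (c * r ^ J)"
      unfolding c_def r_def using assms low by (intro fourier_besov_tail_le[OF B _ _ \<epsilon>]) auto
    then have "measure (std_gaussian B) ?A \<le> c * r ^ J"
      unfolding measure_def using c r by (intro enn2real_leI) auto
    also have "\<dots> < \<epsilon>"
      using J c by (simp add: field_simps)
    finally have "measure (std_gaussian B) ?A < \<epsilon>" .
    moreover have "gauss_measure {x. P x \<in> ?A} = measure (std_gaussian B) ?A"
      by (rule gauss_measure_eq_std_gaussian[OF P B]) measurable
    ultimately show "gauss_measure {x. ennreal \<epsilon> < fourier_besov_norm s p (P x)} < \<epsilon>"
      by simp
  qed
qed

end
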